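(* For every odd integer $m\ge 3$, the Sperner systems $\mathcal{S}^m_1$ and $\mathcal{S}^m_2$ are strongly hypomorphic.
   Context: A set system over a finite set $A$ (the ground set) is a set of subsets of $A$, called blocks; it is a Sperner system if no block is included in another. Set systems $\mathcal A$ over $A$ and $\mathcal B$ over $B$ are isomorphic, $\mathcal A\equiv\mathcal B$, if there is a bijection $\sigma\colon A\to B$ with $\{\sigma(S):S\in\mathcal A\}=\mathcal B$. For a two-element subset $I$ of $A$, let $\theta_I$ be the equivalence relation on $A$ whose only nonsingleton class is $I$; for $S\subseteq A$ let $S_I=\{x/\theta_I:x\in S\}\subseteq A/\theta_I$; for a Sperner system $\mathcal A$ over $A$ let $\mathcal A_I=\{S_I:S\in\mathcal A\}$ and let $\mathcal A^*_I$ be the set of inclusion-minimal elements of $\mathcal A_I$, a Sperner system over $A/\theta_I$. Two Sperner systems $\mathcal A,\mathcal B$ over the same ground set $A$ are strongly hypomorphic if $\mathcal A^*_I\equiv\mathcal B^*_I$ for every two-element subset $I$ of $A$. Let $[m]=\{1,\dots,m\}$. For each $n\in[m]$ let $n'$ be a new element (a primed copy of $n$), and $S'=\{n':n\in S\}$ for $S\subseteq[m]$. Let $E_m=[m]\cup[m]'$ ($2m$ elements). Addition in $[m]$ is modulo $m$ with result in $[m]$; $X+q=\{x+q:x\in X\}$. Let $\rho$ be the permutation of $E_m$ with $\rho(j)=j+1$, $\rho(j')=(j+1)'$; for a set system $\mathcal A$ over $E_m$ let $\langle\mathcal A\rangle=\bigcup_{i\in[m]}\rho^i(\mathcal A)$.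 For $J\subseteq[m]$ let $F^m_J=J\cup([m]\setminus J)'$; $\mathcal F^m_1=\{F^m_J:|J|\text{ odd}\}$, $\mathcal F^m_2=\{F^m_J:|J|\text{ even}\}$. For disjoint $X,Y\subseteq[m]$ let $[X|Y]$ be the set of all $J\subseteq E_m$ such that $|\{x,x'\}\cap J|=2$ for all $x\in X$, $|\{y,y'\}\cap J|=0$ for all $y\in Y$, and $|\{z,z'\}\cap J|=1$ for all $z\in[m]\setminus(X\cup Y)$. Let $\langle X|Y\rangle=\langle[X|Y]\rangle=\bigcup_{q\in[m]}[X+q|Y+q]$. Let $\Omega=\{\langle X|Y\rangle: X,Y\subseteq[m],\ |X|=|Y|,\ X\cap Y=\emptyset\}\setminus\{\langle\emptyset|\emptyset\rangle\}$. Signature: for disjoint $X,Y\subseteq[m]$, $(X,Y)\ne(\emptyset,\emptyset)$, let $d_1\dots d_m$ be the string with $d_i=x$ if $i\in X$, $d_i=y$ if $i\in Y$, $d_i=z$ otherwise. Let $d'_1\dots d'_m$ be the unique string (indices cyclic modulo $m$) such that $d'_i=d_i$ if $d_i\in\{x,y\}$; and if $d_i=z$ then $d'_i\in\{\alpha,\beta\}$, $d'_i\ne d'_{i-1}$, with $d'_i=\beta$ if $d_{i-1}=x$ and $d'_i=\alpha$ if $d_{i-1}=y$. Then $\mathrm{sgn}(X,Y)$ is the set of those $e\in\{\alpha,\beta\}$ that occur an odd number of times in $d'_1\dots d'_m$; the singletons $\{\alpha\},\{\beta\}$ are written $\alpha,\beta$. It is invariant under replacing $(X,Y)$ by $(X+q,Y+q)$,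 and $\mathrm{sgn}\langle X|Y\rangle:=\mathrm{sgn}(X,Y)$ is well defined. For odd $m\ge3$ let $C_m=\{1,3,\dots,m-2\}$, $A_m=\{m\}\cup(C_m+1)\cup(C_m+1)'$, $B_m=\{m\}\cup C_m\cup C_m'$, and $$\mathcal H^m=\langle\{A_m,B_m\}\rangle\cup\bigcup\{Q\in\Omega\setminus\{\langle C_m|C_m+1\rangle,\langle C_m+1|C_m\rangle\}:\mathrm{sgn}\,Q=\beta\}.$$ For $i\in\{1,2\}$ let $\mathcal S^m_i=\mathcal H^m\cup\mathcal F^m_i$, a Sperner system over $E_m$. *)

theory Defs
  imports Main "HOL-Library.FuncSet"
begin

definition set_system :: "'a set \<Rightarrow> 'a set set \<Rightarrow> bool" where
  "set_system A \<A> \<longleftrightarrow> finite A \<and> (\<forall>S\<in>\<A>. S \<subseteq> A)"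

definition sperner_system :: "'a set \<Rightarrow> 'a set set \<Rightarrow> bool" where
  "sperner_system A \<A> \<longleftrightarrow> set_system A \<A> \<and> (\<forall>S\<in>\<A>. \<forall>T\<in>\<A>. S \<subseteq> T \<longrightarrow> S = T)"

definition isomorphic_systems :: "'a set \<Rightarrow> 'a set set \<Rightarrow> 'b set \<Rightarrow> 'b set set \<Rightarrow> bool" where
  "isomorphic_systems A \<A> B \<B> \<longleftrightarrow> (\<exists>\<sigma>. bij_betw \<sigma> A B \<and> {\<sigma> ` S | S. S \<in> \<A>} = \<B>)"

definition theta :: "'a set \<Rightarrow> 'a set \<Rightarrow> ('a \<times> 'a) set" where
  "theta A I = {(x, y). x \<in> A \<and> y \<in> A \<and> (x = y \<or> x \<in> I \<and> y \<in> I)}"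

text \<open>For \<open>S \<subseteq> A\<close>, the library's \<open>S // theta A I\<close> is the set of the classes of the elements
  of \<open>S\<close>.\<close>

definition identify :: "'a set \<Rightarrow> 'a set \<Rightarrow> 'a set set \<Rightarrow> 'a set set set" where
  "identify A I \<A> = {S // theta A I | S. S \<in> \<A>}"

definition minimal_blocks :: "'a set set \<Rightarrow> 'a set set" where
  "minimal_blocks \<A> = {S \<in> \<A>. \<forall>T\<in>\<A>. T \<subseteq> S \<longrightarrow> T = S}"

definition identify_min :: "'a set \<Rightarrow> 'a set \<Rightarrow> 'a set set \<Rightarrow> 'a set set set" where
  "identify_min A I \<A> = minimal_blocks (identify A I \<A>)"

text \<open>Strong hypomorphism is a relation between Sperner systems, so being a Sperner system over
  \<open>A\<close> is part of the definition.\<close>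

definition strongly_hypomorphic :: "'a set \<Rightarrow> 'a set set \<Rightarrow> 'a set set \<Rightarrow> bool" where
  "strongly_hypomorphic A \<A> \<B> \<longleftrightarrow>
     sperner_system A \<A> \<and> sperner_system A \<B> \<and>
     (\<forall>I. I \<subseteq> A \<and> card I = 2 \<longrightarrow>
        isomorphic_systems (A // theta A I) (identify_min A I \<A>)
                           (A // theta A I) (identify_min A I \<B>))"

text \<open>The element \<open>n\<close> of \<open>[m]\<close> is \<open>Inl n\<close>; its primed copy \<open>n'\<close> is \<open>Inr n\<close>.\<close>

type_synonym point = "nat + nat"

definition E :: "nat \<Rightarrow> point set" where
  "E m = Inl ` {1..m} \<union> Inr ` {1..m}"

text \<open>Addition modulo \<open>m\<close> with representatives \<open>1, \<dots>, m\<close>.\<close>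

definition addm :: "nat \<Rightarrow> nat \<Rightarrow> nat \<Rightarrow> nat" where
  "addm m x q = (if (x + q) mod m = 0 then m else (x + q) mod m)"

definition shift :: "nat \<Rightarrow> nat set \<Rightarrow> nat \<Rightarrow> nat set" where
  "shift m X q = (\<lambda>x. addm m x q) ` X"

definition rho :: "nat \<Rightarrow> point \<Rightarrow> point" where
  "rho m = map_sum (\<lambda>j. addm m j 1) (\<lambda>j. addm m j 1)"

definition cyc :: "nat \<Rightarrow> point set set \<Rightarrow> point set set" where
  "cyc m \<A> = (\<Union>i\<in>{1..m}. {(rho m ^^ i) ` S | S. S \<in> \<A>})"

definition F_block :: "nat \<Rightarrow> nat set \<Rightarrow> point set" where
  "F_block m J = Inl ` J \<union> Inr ` ({1..m} - J)"

definition F1 :: "nat \<Rightarrow> point set set" where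
  "F1 m = {F_block m J | J. J \<subseteq> {1..m} \<and> odd (card J)}"

definition F2 :: "nat \<Rightarrow> point set set" where
  "F2 m = {F_block m J | J. J \<subseteq> {1..m} \<and> even (card J)}"

definition bracket :: "nat \<Rightarrow> nat set \<Rightarrow> nat set \<Rightarrow> point set set" where
  "bracket m X Y = {J. J \<subseteq> E m \<and>
     (\<forall>x\<in>X. card ({Inl x, Inr x} \<inter> J) = 2) \<and>
     (\<forall>y\<in>Y. card ({Inl y, Inr y} \<inter> J) = 0) \<and>
     (\<forall>z\<in>{1..m} - (X \<union> Y). card ({Inl z, Inr z} \<inter> J) = 1)}"

definition angle :: "nat \<Rightarrow> nat set \<Rightarrow> nat set \<Rightarrow> point set set" where
  "angle m X Y = cyc m (bracket m X Y)"

definition Omega :: "nat \<Rightarrow> point set set set" where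
  "Omega m = {angle m X Y | X Y. X \<subseteq> {1..m} \<and> Y \<subseteq> {1..m} \<and> card X = card Y \<and> X \<inter> Y = {}}
     - {angle m {} {}}"

datatype letter = Let_x | Let_y | Let_z | Let_alpha | Let_beta

text \<open>Strings of length \<open>m\<close> are functions on \<open>{1..m}\<close>, extended by \<open>undefined\<close>.\<close>

definition d_string :: "nat set \<Rightarrow> nat set \<Rightarrow> nat \<Rightarrow> letter" where
  "d_string X Y i = (if i \<in> X then Let_x else if i \<in> Y then Let_y else Let_z)"

definition cpred :: "nat \<Rightarrow> nat \<Rightarrow> nat" where
  "cpred m i = (if i = 1 then m else i - 1)"

definition is_d'_string :: "nat \<Rightarrow> nat set \<Rightarrow> nat set \<Rightarrow> (nat \<Rightarrow> letter) \<Rightarrow> bool" where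
  "is_d'_string m X Y d' \<longleftrightarrow> d' \<in> extensional {1..m} \<and>
     (\<forall>i\<in>{1..m}.
        (d_string X Y i \<in> {Let_x, Let_y} \<longrightarrow> d' i = d_string X Y i) \<and>
        (d_string X Y i = Let_z \<longrightarrow>
           d' i \<in> {Let_alpha, Let_beta} \<and> d' i \<noteq> d' (cpred m i) \<and>
           (d_string X Y (cpred m i) = Let_x \<longrightarrow> d' i = Let_beta) \<and>
           (d_string X Y (cpred m i) = Let_y \<longrightarrow> d' i = Let_alpha)))"

definition d'_string :: "nat \<Rightarrow> nat set \<Rightarrow> nat set \<Rightarrow> nat \<Rightarrow> letter" where
  "d'_string m X Y = (THE d'. is_d'_string m X Y d')"

definition signature :: "nat \<Rightarrow> nat set \<Rightarrow> nat set \<Rightarrow> letter set" where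
  "signature m X Y =
     {e \<in> {Let_alpha, Let_beta}. odd (card {i \<in> {1..m}. d'_string m X Y i = e})}"

text \<open>The signature of \<open>\<langle>X|Y\<rangle>\<close> does not depend on the representing pair \<open>(X, Y)\<close>.\<close>

definition sgn_angle :: "nat \<Rightarrow> point set set \<Rightarrow> letter set" where
  "sgn_angle m Q = (THE s. \<exists>X Y. X \<subseteq> {1..m} \<and> Y \<subseteq> {1..m} \<and> X \<inter> Y = {} \<and>
     (X, Y) \<noteq> ({}, {}) \<and> Q = angle m X Y \<and> s = signature m X Y)"

definition C_set :: "nat \<Rightarrow> nat set" where
  "C_set m = {j. odd j \<and> j + 2 \<le> m}"

definition A_block :: "nat \<Rightarrow> point set" where
  "A_block m = {Inl m} \<union> Inl ` shift m (C_set m) 1 \<union> Inr ` shift m (C_set m) 1"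

definition B_block :: "nat \<Rightarrow> point set" where
  "B_block m = {Inl m} \<union> Inl ` C_set m \<union> Inr ` C_set m"

definition H_system :: "nat \<Rightarrow> point set set" where
  "H_system m = cyc m {A_block m, B_block m} \<union>
     \<Union> {Q \<in> Omega m - {angle m (C_set m) (shift m (C_set m) 1),
                           angle m (shift m (C_set m) 1) (C_set m)}.
           sgn_angle m Q = {Let_beta}}"

definition S1 :: "nat \<Rightarrow> point set set" where
  "S1 m = H_system m \<union> F1 m"

definition S2 :: "nat \<Rightarrow> point set set" where
  "S2 m = H_system m \<union> F2 m"

end

theory Submission
  imports Defs "HOL-Combinatorics.Transposition"
begin

text \<open>
  Exchanging \<open>q\<close> and \<open>q'\<close> interchanges \<open>\<F>\<^sub>1\<close> and \<open>\<F>\<^sub>2\<close>, and it fixes every \<open>[X|Y]\<close> and all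
  rotations of \<open>A\<^sub>m\<close> and \<open>B\<^sub>m\<close> except the two whose single transversal position is \<open>q\<close>. If
  \<open>I = {j, j'}\<close>, then the exchange at \<open>j\<close> is invisible modulo \<open>\<theta>\<^sub>I\<close>, so the two identified systems
  coincide. Otherwise, as \<open>m\<close> is odd, some \<open>q\<close> is such that, counting cyclically from \<open>q\<close>, one element
  of \<open>I\<close> lies at offset 1 and the other at a nonzero even offset. Exactly one element of \<open>I\<close> then lies
  in each of the two exceptional blocks; after the exchange, adding the other element and dropping
  a third point gives a block of signature \<open>\<beta>\<close> (for \<open>m = 3\<close>, a block of either \<open>\<F>\<^sub>i\<close>), so that modulo
  \<open>\<theta>\<^sub>I\<close> the exceptional blocks contribute nothing to the minimal blocks. Hence the exchange at \<open>q\<close>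
  induces the isomorphism.
\<close>

section \<open>Identification modulo \<open>theta\<close> and minimal blocks\<close>

lemma quotient_theta:
  assumes "I \<subseteq> A" "S \<subseteq> A"
  shows "S // theta A I = (\<lambda>x. if x \<in> I then I else {x}) ` S"
proof -
  have "theta A I `` {x} = (if x \<in> I then I else {x})" if "x \<in> S" for x
    using assms that by (auto simp: theta_def)
  then show ?thesis
    by (auto simp: quotient_def)
qed

text \<open>Once \<open>S\<close> meets \<open>I\<close>, the class \<open>I\<close> already belongs
  to its quotient, so the remaining points of \<open>I\<close> can be added at no cost. This is the
  only way in which the identification enlarges the supply of smaller blocks below.\<close>

lemma quotient_theta_mono:
  assumes "I \<subseteq> A" "S \<subseteq> A" "T \<subseteq> A" and "T \<subseteq> S \<or> T \<subseteq> S \<union> I \<and> S \<inter> I \<noteq> {}"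
  shows "T // theta A I \<subseteq> S // theta A I"
proof
  fix c assume "c \<in> T // theta A I"
  then obtain x where x: "x \<in> T" "c = (if x \<in> I then I else {x})"
    using quotient_theta[OF assms(1,3)] by auto
  obtain y where "y \<in> S" "(if y \<in> I then I else {y}) = c"
  proof (cases "x \<in> S")
    case True
    then show thesis using that x by blast
  next
    case False
    then have "x \<in> I" "S \<inter> I \<noteq> {}"
      using assms(4) x(1) by blast+
    then obtain y where "y \<in> S" "y \<in> I" by blast
    with \<open>x \<in> I\<close> show thesis using that[of y] x by simp
  qed
  then show "c \<in> S // theta A I"
    using quotient_theta[OF assms(1,2)] by auto
qed

text \<open>A minimal \<open>S\<close> contains some \<open>T\<close> of the other family, which in
  turn contains some \<open>S'\<close> of the first. Minimality collapses the chain to a single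
  set.\<close>

lemma minimal_blocks_subset:
  assumes "\<And>S. S \<in> \<A> \<Longrightarrow> \<exists>T\<in>\<B>. T \<subseteq> S" and "\<And>T. T \<in> \<B> \<Longrightarrow> \<exists>S\<in>\<A>. S \<subseteq> T"
  shows "minimal_blocks \<A> \<subseteq> minimal_blocks \<B>"
proof
  fix S assume S: "S \<in> minimal_blocks \<A>"
  have below: "T = S" if T: "T \<in> \<B>" "T \<subseteq> S" for T
  proof -
    obtain S' where S': "S' \<in> \<A>" "S' \<subseteq> T"
      using assms(2)[OF T(1)] by blast
    with T(2) have "S' \<subseteq> S" by simp
    with S S'(1) have "S' = S"
      unfolding minimal_blocks_def by blast
    with S'(2) T(2) show ?thesis by (simp add: subset_antisym)
  qed
  obtain T where T: "T \<in> \<B>" "T \<subseteq> S"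
    using S assms(1)[of S] unfolding minimal_blocks_def by blast
  with below have "S \<in> \<B>" by blast
  with below show "S \<in> minimal_blocks \<B>"
    unfolding minimal_blocks_def by blast
qed

lemma minimal_blocks_eq:
  assumes "\<And>S. S \<in> \<A> \<Longrightarrow> \<exists>T\<in>\<B>. T \<subseteq> S" and "\<And>T. T \<in> \<B> \<Longrightarrow> \<exists>S\<in>\<A>. S \<subseteq> T"
  shows "minimal_blocks \<A> = minimal_blocks \<B>"
  by (rule subset_antisym; rule minimal_blocks_subset; rule assms)

lemma minimal_blocks_image:
  assumes "inj f"
  shows "(`) f ` minimal_blocks \<C> = minimal_blocks ((`) f ` \<C>)"
proof -
  have "(\<forall>T\<in>(`) f ` \<C>. T \<subseteq> f ` S \<longrightarrow> T = f ` S) \<longleftrightarrow> (\<forall>T\<in>\<C>. T \<subseteq> S \<longrightarrow> T = S)" for S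
    by (simp add: inj_image_subset_iff[OF assms] inj_image_eq_iff[OF assms])
  then show ?thesis
    unfolding minimal_blocks_def Compr_image_eq by (simp only:)
qed

text \<open>Since \<sigma> fixes \<open>I\<close> setwise, taking images under \<sigma> permutes the
  classes of \<open>theta A I\<close>, and this permutation commutes with forming minimal blocks.
  Premises \<open>1\<close> and \<open>2\<close> make the transported system and \<B> dominate each
  other, which is enough for equal minimal blocks.\<close>

lemma isomorphic_identify_min:
  assumes bij: "bij \<sigma>" and A: "\<sigma> ` A = A" and I: "\<sigma> ` I = I" "I \<subseteq> A"
    and sub: "\<And>S. S \<in> \<A> \<Longrightarrow> S \<subseteq> A"
    and 1: "\<And>S. S \<in> \<A> \<Longrightarrow> \<exists>T\<in>\<B>. T // theta A I \<subseteq> (\<sigma> ` S) // theta A I"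
    and 2: "\<And>T. T \<in> \<B> \<Longrightarrow> \<exists>S\<in>\<A>. (\<sigma> ` S) // theta A I \<subseteq> T // theta A I"
  shows "isomorphic_systems (A // theta A I) (identify_min A I \<A>) (A // theta A I) (identify_min A I \<B>)"
proof -
  let ?c = "\<lambda>x. if x \<in> I then I else {x}"
  let ?\<Phi> = "\<lambda>S. (`) \<sigma> ` S"
  have inj: "inj \<sigma>" using bij by (rule bij_is_inj)
  have inj1: "inj ((`) \<sigma>)"
    using inj by (intro injI) (simp only: inj_image_eq_iff)
  have "\<sigma> x \<in> I \<longleftrightarrow> x \<in> I" for x
    using inj_image_mem_iff[OF inj, of x I] I(1) by simp
  then have c: "\<sigma> ` ?c x = ?c (\<sigma> x)" for x
    using I(1) by simp
  have push: "?\<Phi> (S // theta A I) = (\<sigma> ` S) // theta A I" if "S \<subseteq> A" for S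
  proof -
    have "\<sigma> ` S \<subseteq> A" using that A by blast
    then show ?thesis
      using that c by (simp only: quotient_theta[OF I(2)] image_image)
  qed
  have push_id: "?\<Phi> ` identify A I \<A> = identify A I ((`) \<sigma> ` \<A>)"
  proof -
    have "?\<Phi> ` identify A I \<A> = (\<lambda>S. ?\<Phi> (S // theta A I)) ` \<A>"
      by (auto simp: identify_def)
    also have "\<dots> = (\<lambda>S. (\<sigma> ` S) // theta A I) ` \<A>"
      using push sub by (intro image_cong) auto
    also have "\<dots> = identify A I ((`) \<sigma> ` \<A>)"
      by (auto simp: identify_def)
    finally show ?thesis .
  qed
  have "?\<Phi> ` identify_min A I \<A> = minimal_blocks (identify A I ((`) \<sigma> ` \<A>))"
    by (simp add: identify_min_def minimal_blocks_image[OF inj1] push_id)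
  also have "\<dots> = identify_min A I \<B>"
    unfolding identify_min_def
  proof (rule minimal_blocks_eq)
    fix S assume "S \<in> identify A I ((`) \<sigma> ` \<A>)"
    then obtain S' where "S' \<in> \<A>" "S = (\<sigma> ` S') // theta A I"
      unfolding identify_def Setcompr_eq_image by auto
    with 1[of S'] show "\<exists>T\<in>identify A I \<B>. T \<subseteq> S"
      unfolding identify_def Setcompr_eq_image by simp
  next
    fix T assume "T \<in> identify A I \<B>"
    then obtain T' where "T' \<in> \<B>" "T = T' // theta A I"
      unfolding identify_def Setcompr_eq_image by auto
    with 2[of T'] show "\<exists>S\<in>identify A I ((`) \<sigma> ` \<A>). S \<subseteq> T"
      unfolding identify_def Setcompr_eq_image by simp
  qed
  finally have "?\<Phi> ` identify_min A I \<A> = identify_min A I \<B>" .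
  moreover have "bij_betw ((`) \<sigma>) (A // theta A I) (A // theta A I)"
    using push[OF subset_refl] A inj1 by (simp add: bij_betw_def inj_on_subset[OF _ subset_UNIV])
  ultimately show ?thesis
    unfolding isomorphic_systems_def Setcompr_eq_image by (intro exI[of _ "(`) \<sigma>"]) simp
qed

section \<open>Cyclic offsets and rotations\<close>

text \<open>\<open>p - q\<close> modulo \<open>m\<close>, in \<open>{0..<m}\<close>, for \<open>p\<close> and \<open>q\<close> in \<open>{1..m}\<close>.\<close>

definition offset :: "nat \<Rightarrow> nat \<Rightarrow> nat \<Rightarrow> nat" where
  "offset m q p = (if q \<le> p then p - q else p + m - q)"

text \<open>A set described by a predicate on offsets has a size independent of the base point
  \<open>q\<close>, and a rotation changes nothing in the description except
  \<open>q\<close>.\<close>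

definition at_offset :: "nat \<Rightarrow> (nat \<Rightarrow> bool) \<Rightarrow> nat \<Rightarrow> nat set" where
  "at_offset m P q = {p \<in> {1..m}. P (offset m q p)}"

text \<open>For \<open>x\<close> in \<open>{1..m}\<close> and \<open>i \<le> m\<close> this is
  \<open>addm m x i\<close>, with \<open>mod\<close> replaced by a single comparison so that linear
  arithmetic applies.\<close>

definition rot :: "nat \<Rightarrow> nat \<Rightarrow> nat \<Rightarrow> nat" where
  "rot m i x = (if x + i \<le> m then x + i else x + i - m)"

lemma bij_betw_offset:
  assumes "q \<in> {1..m}"
  shows "bij_betw (offset m q) {1..m} {..<m}"
  using assms
  \<comment> \<open>The point at offset \<open>t\<close> from \<open>q\<close> is
    \<open>q + t\<close>, hence the inverse \<open>rot m t q\<close> with \<open>t\<close> as the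
    amount of rotation.\<close>
  by (intro bij_betw_byWitness[where f' = "\<lambda>t. rot m t q"])
    (auto simp: offset_def rot_def)

lemma card_at_offset:
  assumes "q \<in> {1..m}"
  shows "card (at_offset m P q) = card {t. t < m \<and> P t}"
proof -
  note bij = bij_betw_offset[OF assms]
  have "offset m q ` at_offset m P q = {t \<in> offset m q ` {1..m}. P t}"
    unfolding at_offset_def Compr_image_eq ..
  also have "\<dots> = {t. t < m \<and> P t}"
    unfolding bij_betw_imp_surj_on[OF bij] by auto
  finally have "offset m q ` at_offset m P q = {t. t < m \<and> P t}" .
  moreover have "inj_on (offset m q) (at_offset m P q)"
    using bij_betw_imp_inj_on[OF bij] by (rule inj_on_subset) (auto simp: at_offset_def)
  ultimately show ?thesis
    using card_image by fastforce
qed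

lemma bij_betw_rot:
  assumes "i \<le> m"
  shows "bij_betw (rot m i) {1..m} {1..m}"
  using assms
  by (intro bij_betw_byWitness[where f' = "rot m (m - i)"]) (auto simp: rot_def)

lemma offset_rot:
  assumes "i \<le> m" "p \<in> {1..m}" "q \<in> {1..m}"
  shows "offset m (rot m i q) (rot m i p) = offset m q p"
  using assms by (auto simp: offset_def rot_def)

lemma rot_at_offset:
  assumes "i \<le> m" "q \<in> {1..m}"
  shows "rot m i ` at_offset m P q = at_offset m P (rot m i q)"
proof
  show "rot m i ` at_offset m P q \<subseteq> at_offset m P (rot m i q)"
  proof
    fix p assume "p \<in> rot m i ` at_offset m P q"
    then obtain r where "r \<in> {1..m}" "P (offset m q r)" "p = rot m i r"
      by (auto simp: at_offset_def)
    with assms offset_rot[of i m r q] bij_betwE[OF bij_betw_rot[OF assms(1)]]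
    show "p \<in> at_offset m P (rot m i q)"
      by (simp add: at_offset_def)
  qed
  show "at_offset m P (rot m i q) \<subseteq> rot m i ` at_offset m P q"
  proof
    fix p assume p: "p \<in> at_offset m P (rot m i q)"
    then have "p \<in> rot m i ` {1..m}"
      using bij_betw_rot[OF assms(1)] by (simp add: at_offset_def bij_betw_def)
    with p assms show "p \<in> rot m i ` at_offset m P q"
      by (auto simp: at_offset_def offset_rot)
  qed
qed

lemma rho_power:
  assumes "s \<in> E m" "i \<le> m"
  shows "(rho m ^^ i) s = map_sum (rot m i) (rot m i) s"
  using assms(2)
proof (induction i)
  case 0
  show ?case using assms(1) by (auto simp: E_def rot_def)
next
  case (Suc i)
  have "addm m (rot m i x) 1 = rot m (Suc i) x" if "x \<in> {1..m}" for x
    using that Suc.prems by (auto simp: addm_def rot_def le_Suc_eq mod_if)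
  with Suc assms(1) show ?case
    by (auto simp: E_def rho_def)
qed

lemma rho_power_image:
  assumes "S \<subseteq> E m" "i \<le> m"
  shows "(rho m ^^ i) ` S = map_sum (rot m i) (rot m i) ` S"
  using assms rho_power by (intro image_cong) auto

lemma rot_self: "x \<in> {1..m} \<Longrightarrow> rot m m x = x"
  by (auto simp: rot_def)

lemma bij_betw_map_sum_rot:
  assumes "i \<le> m"
  shows "bij_betw (map_sum (rot m i) (rot m i)) (E m) (E m)"
proof -
  have "map_sum f f ` (Inl ` A \<union> Inr ` A) = Inl ` f ` A \<union> Inr ` f ` A" for f :: "nat \<Rightarrow> nat" and A
    by (simp add: image_Un image_image)
  then have "map_sum (rot m i) (rot m i) ` E m = E m"
    by (simp only: E_def bij_betw_imp_surj_on[OF bij_betw_rot[OF assms]])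
  moreover have "inj_on (map_sum (rot m i) (rot m i)) (E m)"
  proof (rule inj_onI)
    fix s t assume "s \<in> E m" "t \<in> E m" "map_sum (rot m i) (rot m i) s = map_sum (rot m i) (rot m i) t"
    then show "s = t"
      using inj_on_eq_iff[OF bij_betw_imp_inj_on[OF bij_betw_rot[OF assms]]]
      by (auto simp: E_def)
  qed
  ultimately show ?thesis by (simp add: bij_betw_def)
qed

section \<open>Blocks described by their doubled and missing positions\<close>

definition doubles :: "point set \<Rightarrow> nat set" where
  "doubles S = {p. Inl p \<in> S \<and> Inr p \<in> S}"

definition missing :: "nat \<Rightarrow> point set \<Rightarrow> nat set" where
  "missing m S = {p \<in> {1..m}. Inl p \<notin> S \<and> Inr p \<notin> S}"

lemma card_pair_Int:
  "card ({Inl x, Inr x} \<inter> J) = of_bool (Inl x \<in> J) + of_bool (Inr x \<in> J)"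
  by (auto simp: Int_insert_left)

text \<open>Any single block of \<open>[X|Y]\<close> determines \<open>X\<close> and
  \<open>Y\<close>. Hence one common block suffices to compare two brackets or two orbits.\<close>

lemma bracket_iff:
  assumes "X \<subseteq> {1..m}" "Y \<subseteq> {1..m}" "X \<inter> Y = {}"
  shows "S \<in> bracket m X Y \<longleftrightarrow> S \<subseteq> E m \<and> doubles S = X \<and> missing m S = Y"
proof
  assume "S \<in> bracket m X Y"
  then have S: "S \<subseteq> E m" "\<forall>x\<in>X. Inl x \<in> S \<and> Inr x \<in> S" "\<forall>y\<in>Y. Inl y \<notin> S \<and> Inr y \<notin> S"
    "\<forall>z\<in>{1..m} - (X \<union> Y). Inl z \<in> S \<longleftrightarrow> Inr z \<notin> S"
    unfolding bracket_def card_pair_Int by (auto simp: of_bool_def split: if_splits)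
  moreover have "doubles S \<subseteq> {1..m}"
    using S(1) by (auto simp: doubles_def E_def)
  ultimately show "S \<subseteq> E m \<and> doubles S = X \<and> missing m S = Y"
    using assms by (auto simp: doubles_def missing_def)
next
  assume "S \<subseteq> E m \<and> doubles S = X \<and> missing m S = Y"
  then show "S \<in> bracket m X Y"
    unfolding bracket_def card_pair_Int by (auto simp: doubles_def missing_def)
qed

lemma bracket_nonempty:
  assumes "X \<subseteq> {1..m}" "Y \<subseteq> {1..m}" "X \<inter> Y = {}"
  shows "bracket m X Y \<noteq> {}"
proof -
  have "Inl ` ({1..m} - Y) \<union> Inr ` X \<in> bracket m X Y"
    unfolding bracket_iff[OF assms] using assms by (auto simp: doubles_def missing_def E_def)
  then show ?thesis by blast
qed

lemma doubles_rot:
  assumes "S \<subseteq> E m" "i \<le> m"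
  shows "doubles (map_sum (rot m i) (rot m i) ` S) = rot m i ` doubles S"
proof -
  \<comment> \<open>Injectivity of the rotation ensures that both halves of a doubled pair in the
    image come from the same position.\<close>
  have "x = y" if "Inl x \<in> S" "Inr y \<in> S" "rot m i x = rot m i y" for x y
  proof -
    have "x \<in> {1..m}" "y \<in> {1..m}"
      using subsetD[OF assms(1) that(1)] subsetD[OF assms(1) that(2)] by (auto simp: E_def)
    with that(3) show ?thesis
      using inj_onD[OF bij_betw_imp_inj_on[OF bij_betw_rot[OF assms(2)]]] by blast
  qed
  moreover have "Inl z = map_sum f g s \<longleftrightarrow> (\<exists>x. s = Inl x \<and> z = f x)"
    for z s and f g :: "nat \<Rightarrow> nat"
    by (cases s) auto
  moreover have "Inr z = map_sum f g s \<longleftrightarrow> (\<exists>x. s = Inr x \<and> z = g x)"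
    for z s and f g :: "nat \<Rightarrow> nat"
    by (cases s) auto
  ultimately show ?thesis
    by (auto simp: doubles_def image_iff)
qed

lemma missing_rot:
  assumes "S \<subseteq> E m" "i \<le> m"
  shows "missing m (map_sum (rot m i) (rot m i) ` S) = rot m i ` missing m S"
proof -
  let ?f = "map_sum (rot m i) (rot m i)"
  note b = bij_betw_rot[OF assms(2)]
  note inj = bij_betw_imp_inj_on[OF bij_betw_map_sum_rot[OF assms(2)]]
  have mem: "?f s \<in> ?f ` S \<longleftrightarrow> s \<in> S" if "s \<in> E m" for s
    using inj_on_image_mem_iff[OF inj that assms(1)] .
  have "p \<in> missing m (?f ` S) \<longleftrightarrow> p \<in> rot m i ` missing m S" if p: "p \<in> {1..m}" for p
  proof -
    obtain r where r: "r \<in> {1..m}" "p = rot m i r"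
      using p bij_betw_imp_surj_on[OF b] by blast
    have "p \<in> missing m (?f ` S) \<longleftrightarrow> Inl p \<notin> ?f ` S \<and> Inr p \<notin> ?f ` S"
      using p by (simp add: missing_def)
    also have "\<dots> \<longleftrightarrow> Inl r \<notin> S \<and> Inr r \<notin> S"
      using mem[of "Inl r"] mem[of "Inr r"] r by (simp add: E_def)
    also have "\<dots> \<longleftrightarrow> r \<in> missing m S"
      using r(1) by (simp add: missing_def)
    also have "\<dots> \<longleftrightarrow> p \<in> rot m i ` missing m S"
    proof -
      have "missing m S \<subseteq> {1..m}" by (auto simp: missing_def)
      from inj_on_image_mem_iff[OF bij_betw_imp_inj_on[OF b] r(1) this] r(2)
      show ?thesis by simp
    qed
    finally show ?thesis .
  qed
  moreover have "rot m i ` missing m S \<subseteq> {1..m}"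
    using bij_betw_imp_surj_on[OF b] by (auto simp: missing_def)
  moreover have "missing m (?f ` S) \<subseteq> {1..m}"
    by (auto simp: missing_def)
  ultimately show ?thesis by blast
qed

lemma angle_subset:
  assumes "X \<subseteq> {1..m}" "Y \<subseteq> {1..m}" "X \<inter> Y = {}" "S \<in> angle m X Y"
  obtains i where "i \<le> m" "S \<subseteq> E m" "doubles S = rot m i ` X" "missing m S = rot m i ` Y"
proof -
  obtain i J where i: "i \<le> m" "J \<in> bracket m X Y" "S = (rho m ^^ i) ` J"
    using assms(4) by (auto simp: angle_def cyc_def)
  then have J: "J \<subseteq> E m" "doubles J = X" "missing m J = Y"
    using bracket_iff[OF assms(1-3)] by auto
  have S: "S = map_sum (rot m i) (rot m i) ` J"
    using i J rho_power_image by simp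
  moreover have "S \<subseteq> E m"
    unfolding S using J bij_betw_imp_surj_on[OF bij_betw_map_sum_rot[OF i(1)]] by blast
  ultimately show thesis
    using that[OF i(1)] doubles_rot[OF J(1) i(1)] missing_rot[OF J(1) i(1)] J by simp
qed

lemma bracket_subset_angle:
  assumes "m \<ge> 1"
  shows "bracket m X Y \<subseteq> angle m X Y"
proof
  fix S assume S: "S \<in> bracket m X Y"
  then have "S \<subseteq> E m" by (simp add: bracket_def)
  \<comment> \<open>The exponents in \<open>cyc\<close> run from 1 to \<open>m\<close>, so the
    identity occurs as the \<open>m\<close>-th power.\<close>
  have "(rho m ^^ m) s = s" if "s \<in> S" for s
  proof -
    have s: "s \<in> E m" using that \<open>S \<subseteq> E m\<close> by blast
    then show ?thesis
      unfolding rho_power[OF s order_refl] by (auto simp: E_def rot_self)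
  qed
  then have "S = (rho m ^^ m) ` S" by simp
  with S have "S \<in> {(rho m ^^ m) ` S | S. S \<in> bracket m X Y}" by blast
  moreover have "m \<in> {1..m}" using assms by simp
  ultimately show "S \<in> angle m X Y"
    unfolding angle_def cyc_def by (rule UN_I[rotated])
qed

text \<open>A block of \<open>[X'|Y']\<close> lies in the orbit of \<open>[X|Y]\<close>. Its doubled
  and missing positions are \<open>X'\<close> and \<open>Y'\<close> and also the images of
  \<open>X\<close> and \<open>Y\<close> under one common rotation.\<close>

lemma angle_eqD:
  assumes "m \<ge> 1" "angle m X Y = angle m X' Y'"
    and "X \<subseteq> {1..m}" "Y \<subseteq> {1..m}" "X \<inter> Y = {}"
    and "X' \<subseteq> {1..m}" "Y' \<subseteq> {1..m}" "X' \<inter> Y' = {}"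
  obtains i where "i \<le> m" "X' = rot m i ` X" "Y' = rot m i ` Y"
proof -
  obtain J where J: "J \<in> bracket m X' Y'"
    using bracket_nonempty[OF assms(6-8)] by blast
  then have "J \<in> angle m X Y"
    using bracket_subset_angle[OF assms(1)] assms(2) by blast
  from angle_subset[OF assms(3-5) this] obtain i where
    "i \<le> m" "doubles J = rot m i ` X" "missing m J = rot m i ` Y" .
  then show thesis
    using that J bracket_iff[OF assms(6-8)] by auto
qed

text \<open>Inclusion-exclusion for the unprimed and the primed part of \<open>S\<close>: their
  intersection is \<open>doubles S\<close>, and their union is the complement of
  \<open>missing m S\<close>. With equally many doubled and missing positions, a block has exactly
  \<open>m\<close> points.\<close>

lemma card_block:
  assumes "S \<subseteq> E m"
  shows "card S + card (missing m S) = m + card (doubles S)"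
proof -
  let ?L = "Inl -` S" and ?R = "Inr -` S"
  have sub: "?L \<subseteq> {1..m}" "?R \<subseteq> {1..m}"
    using assms by (auto simp: E_def)
  then have fin: "finite ?L" "finite ?R"
    by (auto intro: finite_subset)
  have "S = Inl ` ?L \<union> Inr ` ?R"
    by (auto simp: image_iff) (metis sum.exhaust)
  then have "card S = card (Inl ` ?L \<union> Inr ` ?R :: point set)"
    by simp
  also have "\<dots> = card ?L + card ?R"
    using fin by (subst card_Un_disjoint) (auto simp: card_image simp del: image_vimage_eq)
  also have "\<dots> = card (?L \<union> ?R) + card (?L \<inter> ?R)"
    using fin by (rule card_Un_Int)
  also have "?L \<inter> ?R = doubles S"
    by (auto simp: doubles_def)
  finally have "card S = card (?L \<union> ?R) + card (doubles S)" .
  moreover have "missing m S = {1..m} - (?L \<union> ?R)"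
    by (auto simp: missing_def)
  moreover have "card ({1..m} - (?L \<union> ?R)) + card (?L \<union> ?R) = m"
    using sub fin by (subst card_Diff_subset) (auto simp: card_mono[of "{1..m}", simplified])
  ultimately show ?thesis by simp
qed

section \<open>Computing signatures\<close>

text \<open>The string is prescribed at a position \<open>q\<close> of \<open>X \<union> Y\<close>.
  Every further letter is determined by its predecessor: it is prescribed after \<open>x\<close> or
  \<open>y\<close>, and it alternates after \<alpha> or \<beta>. Going once around the cycle from
  \<open>q\<close> fixes all letters.\<close>

lemma is_d'_string_unique:
  assumes "is_d'_string m X Y d" "is_d'_string m X Y e"
    and "X \<subseteq> {1..m}" "Y \<subseteq> {1..m}" "X \<union> Y \<noteq> {}"
  shows "d = e"
proof -
  obtain q where q: "q \<in> X \<union> Y" "q \<in> {1..m}"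
    using assms(3-5) by blast
  have step: "d i = e i" if "d (cpred m i) = e (cpred m i)" "i \<in> {1..m}" for i
  proof (cases "d_string X Y i = Let_z")
    case False
    then have "d_string X Y i \<in> {Let_x, Let_y}"
      by (auto simp: d_string_def split: if_splits)
    then show ?thesis
      using assms(1,2) that(2) unfolding is_d'_string_def by metis
  next
    case True
    then have "d i \<in> {Let_alpha, Let_beta}" "e i \<in> {Let_alpha, Let_beta}"
      "d i \<noteq> d (cpred m i)" "e i \<noteq> e (cpred m i)"
      "d_string X Y (cpred m i) = Let_x \<longrightarrow> d i = Let_beta \<and> e i = Let_beta"
      "d_string X Y (cpred m i) = Let_y \<longrightarrow> d i = Let_alpha \<and> e i = Let_alpha"
      using assms(1,2) that(2) unfolding is_d'_string_def by auto
    moreover have "cpred m i \<in> {1..m}"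
      using that(2) by (auto simp: cpred_def)
    then have "d_string X Y (cpred m i) = Let_z \<longrightarrow> d (cpred m i) \<in> {Let_alpha, Let_beta}"
      using assms(1) unfolding is_d'_string_def by auto
    moreover have "d_string X Y (cpred m i) \<in> {Let_x, Let_y, Let_z}"
      by (auto simp: d_string_def)
    ultimately show ?thesis
      using that(1) by auto
  qed
  have "d (rot m t q) = e (rot m t q)" if "t < m" for t
    using that
  proof (induction t)
    case 0
    have "d_string X Y q \<in> {Let_x, Let_y}"
      using q(1) by (auto simp: d_string_def)
    then have "d q = e q"
      using assms(1,2) q(2) unfolding is_d'_string_def by metis
    then show ?case
      using q(2) by (simp add: rot_def)
  next
    case (Suc t)
    have "cpred m (rot m (Suc t) q) = rot m t q"
      using Suc.prems q(2) by (auto simp: cpred_def rot_def)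
    moreover have "rot m (Suc t) q \<in> {1..m}"
      using Suc.prems q(2) by (auto simp: rot_def)
    ultimately show ?case
      using step Suc by simp
  qed
  moreover have "p = rot m (offset m q p) q" "offset m q p < m" if "p \<in> {1..m}" for p
    using that q(2) by (auto simp: rot_def offset_def)
  ultimately have "d p = e p" if "p \<in> {1..m}" for p
    using that by metis
  then show ?thesis
    using assms(1,2) unfolding is_d'_string_def by (intro extensionalityI[of _ "{1..m}"]) auto
qed

text \<open>A candidate \<open>D\<close>, read along the cycle from \<open>q\<close>, is certified
  by local conditions. Uniqueness identifies it with the string chosen by \<open>THE\<close>, whose
  letters can then be counted in \<open>D\<close>. Here \<open>u\<close> is the cyclic predecessor
  of \<open>t\<close>, so 0 is preceded by \<open>m - 1\<close>.\<close>

lemma signature_at_offset: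
  assumes q: "q \<in> {1..m}" and ne: "\<exists>t<m. P t \<or> R t"
    and disj: "\<And>t. P t \<Longrightarrow> \<not> R t"
    and x: "\<And>t. t < m \<Longrightarrow> P t \<Longrightarrow> D t = Let_x"
    and y: "\<And>t. t < m \<Longrightarrow> R t \<Longrightarrow> D t = Let_y"
    and z: "\<And>t. t < m \<Longrightarrow> \<not> P t \<Longrightarrow> \<not> R t \<Longrightarrow>
      (let u = (if t = 0 then m - 1 else t - 1)
       in D t \<in> {Let_alpha, Let_beta} \<and> D t \<noteq> D u \<and> (P u \<longrightarrow> D t = Let_beta) \<and> (R u \<longrightarrow> D t = Let_alpha))"
  shows "signature m (at_offset m P q) (at_offset m R q) =
    {e \<in> {Let_alpha, Let_beta}. odd (card {t. t < m \<and> D t = e})}"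
proof -
  let ?X = "at_offset m P q" and ?Y = "at_offset m R q"
  let ?d = "restrict (\<lambda>p. D (offset m q p)) {1..m}"
  have lt: "offset m q p < m" if "p \<in> {1..m}" for p
    using that q by (auto simp: offset_def)
  have pred: "offset m q (cpred m p) = (if offset m q p = 0 then m - 1 else offset m q p - 1)"
    "cpred m p \<in> {1..m}" if "p \<in> {1..m}" for p
    using that q by (auto simp: offset_def cpred_def)
  have str: "d_string ?X ?Y p = (if P (offset m q p) then Let_x else if R (offset m q p) then Let_y else Let_z)"
    if "p \<in> {1..m}" for p
    using that by (auto simp: d_string_def at_offset_def)
  have isd: "is_d'_string m ?X ?Y ?d"
    unfolding is_d'_string_def
  proof (intro conjI ballI impI)
    fix p assume p: "p \<in> {1..m}"
    show "?d p = d_string ?X ?Y p" if "d_string ?X ?Y p \<in> {Let_x, Let_y}"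
      using that p lt[OF p] x y disj by (auto simp: str split: if_splits)
    assume "d_string ?X ?Y p = Let_z"
    then have "\<not> P (offset m q p)" "\<not> R (offset m q p)"
      using p by (auto simp: str split: if_splits)
    note * = z[OF lt[OF p] this, unfolded Let_def, folded pred(1)[OF p]]
    show "?d p \<in> {Let_alpha, Let_beta}" "?d p \<noteq> ?d (cpred m p)"
      using * p pred(2)[OF p] by auto
    show "?d p = Let_beta" if "d_string ?X ?Y (cpred m p) = Let_x"
      using * p that pred(2)[OF p] by (auto simp: str split: if_splits)
    show "?d p = Let_alpha" if "d_string ?X ?Y (cpred m p) = Let_y"
      using * p that pred(2)[OF p] by (auto simp: str split: if_splits)
  qed auto
  have sub: "?X \<subseteq> {1..m}" "?Y \<subseteq> {1..m}"
    by (auto simp: at_offset_def)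
  have "?X \<union> ?Y \<noteq> {}"
  proof -
    obtain t where "t < m" "P t \<or> R t" using ne by blast
    moreover have "t \<in> offset m q ` {1..m}"
      using \<open>t < m\<close> bij_betw_imp_surj_on[OF bij_betw_offset[OF q]] by simp
    ultimately show ?thesis by (auto simp: at_offset_def)
  qed
  then have "d'_string m ?X ?Y = ?d"
    unfolding d'_string_def
    by (intro the_equality[where P = "is_d'_string m ?X ?Y", OF isd] is_d'_string_unique[OF _ isd sub])
  moreover have "card {i \<in> {1..m}. ?d i = e} = card {t. t < m \<and> D t = e}" for e
  proof -
    have "{i \<in> {1..m}. ?d i = e} = at_offset m (\<lambda>t. D t = e) q"
      by (auto simp: at_offset_def)
    then show ?thesis using card_at_offset[OF q] by simp
  qed
  ultimately show ?thesis
    unfolding signature_def by simp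
qed

section \<open>Exchanging a point with its primed copy\<close>

abbreviation swap :: "nat \<Rightarrow> point \<Rightarrow> point" where
  "swap p \<equiv> transpose (Inl p) (Inr p)"

text \<open>With the parity as a Boolean index, an exchange negates the index, and each argument
  covers both directions between \<F>\<open>\<^sub>1\<close> and
  \<F>\<open>\<^sub>2\<close>.\<close>

definition F_parity :: "nat \<Rightarrow> bool \<Rightarrow> point set set" where
  "F_parity m e = {F_block m J | J. J \<subseteq> {1..m} \<and> even (card J) = e}"

lemma F1_eq: "F1 m = F_parity m False" and F2_eq: "F2 m = F_parity m True"
  by (simp_all add: F1_def F2_def F_parity_def)

lemma swap_subset_E:
  assumes "p \<in> {1..m}" "S \<subseteq> E m"
  shows "swap p ` S \<subseteq> E m"
proof -
  have "swap p ` E m = E m"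
    using assms(1) by (intro transpose_image_eq) (auto simp: E_def)
  with assms(2) show ?thesis by (metis image_mono)
qed

lemma swap_swap_image: "swap p ` swap p ` S = S"
  by (simp add: image_image)

lemma doubles_swap: "doubles (swap p ` S) = doubles S"
  by (auto simp: doubles_def in_transpose_image_iff transpose_def split: if_splits)

lemma missing_swap: "missing m (swap p ` S) = missing m S"
  by (auto simp: missing_def in_transpose_image_iff transpose_def split: if_splits)

lemma swap_F_block:
  assumes "p \<in> {1..m}"
  shows "swap p ` F_block m J = F_block m (if p \<in> J then J - {p} else insert p J)"
proof (rule set_eqI)
  show "s \<in> swap p ` F_block m J \<longleftrightarrow> s \<in> F_block m (if p \<in> J then J - {p} else insert p J)" for s
    using assms by (cases s) (auto simp: F_block_def in_transpose_image_iff transpose_def image_iff)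
qed

lemma swap_F_parity:
  assumes "S \<in> F_parity m e" "p \<in> {1..m}"
  shows "swap p ` S \<in> F_parity m (\<not> e)"
proof -
  obtain J where J: "S = F_block m J" "J \<subseteq> {1..m}" "even (card J) = e"
    using assms(1) by (auto simp: F_parity_def)
  let ?K = "if p \<in> J then J - {p} else insert p J"
  have "finite J" using J(2) by (rule finite_subset) simp
  have "even (card ?K) = (\<not> e)"
  proof (cases "p \<in> J")
    case True
    with J(3) card.remove[OF \<open>finite J\<close> True] show ?thesis
      by (cases e) (simp_all del: card_Diff_insert)
  next
    case False
    with J(3) \<open>finite J\<close> show ?thesis by simp
  qed
  moreover have "?K \<subseteq> {1..m}"
    using J(2) assms(2) by auto
  ultimately show ?thesis
    unfolding F_parity_def J(1) swap_F_block[OF assms(2)] by blast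
qed

lemma bracket_empty_F_parity:
  assumes "S \<in> bracket m {} {}"
  shows "\<exists>e. S \<in> F_parity m e"
proof -
  have S: "S \<subseteq> E m" "doubles S = {}" "missing m S = {}"
    using assms bracket_iff[of "{}" m "{}"] by auto
  let ?J = "{j \<in> {1..m}. Inl j \<in> S}"
  have "s \<in> S \<longleftrightarrow> s \<in> F_block m ?J" for s
    using S by (cases s) (auto simp: F_block_def E_def doubles_def missing_def image_iff)
  then have "S = F_block m ?J" by blast
  moreover have "?J \<subseteq> {1..m}" by blast
  ultimately show ?thesis
    unfolding F_parity_def by blast
qed

lemma F_block_card:
  assumes "S \<in> F_parity m e"
  shows "S \<subseteq> E m" "card S = m"
proof -
  obtain J where J: "S = F_block m J" "J \<subseteq> {1..m}"
    using assms by (auto simp: F_parity_def)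
  then show "S \<subseteq> E m" by (auto simp: F_block_def E_def)
  from card_block[OF this] J show "card S = m"
    by (simp add: F_block_def doubles_def missing_def image_iff) (smt (verit) Collect_empty_eq card.empty add_0_right)
qed

lemma bracket_swap:
  assumes "S \<in> bracket m X Y" "p \<in> {1..m}" "X \<subseteq> {1..m}" "Y \<subseteq> {1..m}" "X \<inter> Y = {}"
  shows "swap p ` S \<in> bracket m X Y"
  using assms(1,2) swap_subset_E unfolding bracket_iff[OF assms(3-5)] doubles_swap missing_swap by blast

text \<open>The exchange at \<open>p\<close> after a rotation equals the exchange at the preimage
  \<open>r\<close> of \<open>p\<close> before it. Brackets are invariant under every exchange,
  because doubled and missing positions do not change.\<close>

lemma angle_swap:
  assumes "S \<in> angle m X Y" "p \<in> {1..m}" "X \<subseteq> {1..m}" "Y \<subseteq> {1..m}" "X \<inter> Y = {}"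
  shows "swap p ` S \<in> angle m X Y"
proof -
  obtain i J where i: "i \<in> {1..m}" "J \<in> bracket m X Y" "S = (rho m ^^ i) ` J"
    using assms(1) by (auto simp: angle_def cyc_def)
  then have im: "i \<le> m" and J: "J \<subseteq> E m" by (auto simp: bracket_def)
  note bij = bij_betw_rot[OF im]
  obtain r where r: "r \<in> {1..m}" "p = rot m i r"
    using assms(2) bij_betw_imp_surj_on[OF bij] by blast
  have "swap p (map_sum (rot m i) (rot m i) s) = map_sum (rot m i) (rot m i) (swap r s)" if "s \<in> E m" for s
    using that r inj_on_eq_iff[OF bij_betw_imp_inj_on[OF bij]]
    by (auto simp: E_def transpose_def)
  then have "swap p ` map_sum (rot m i) (rot m i) ` J = map_sum (rot m i) (rot m i) ` swap r ` J"
    using J unfolding image_image by (intro image_cong) auto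
  then have "swap p ` S = (rho m ^^ i) ` swap r ` J"
    unfolding i(3) rho_power_image[OF J im] rho_power_image[OF swap_subset_E[OF r(1) J] im] .
  moreover have "swap r ` J \<in> bracket m X Y"
    using bracket_swap[OF i(2) r(1) assms(3-5)] .
  ultimately show ?thesis
    unfolding angle_def cyc_def using i(1) by blast
qed

lemma angle_card:
  assumes "S \<in> angle m X Y" "X \<subseteq> {1..m}" "Y \<subseteq> {1..m}" "X \<inter> Y = {}" "card X = card Y"
  shows "S \<subseteq> E m" "card S = m"
proof -
  from angle_subset[OF assms(2-4,1)] obtain i where
    i: "i \<le> m" "S \<subseteq> E m" "doubles S = rot m i ` X" "missing m S = rot m i ` Y" .
  show "S \<subseteq> E m" by (rule i(2))
  have "card (rot m i ` Z) = card Z" if "Z \<subseteq> {1..m}" for Z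
    using inj_on_subset[OF bij_betw_imp_inj_on[OF bij_betw_rot[OF i(1)]] that] by (rule card_image)
  then show "card S = m"
    using card_block[OF i(2)] assms i by simp
qed

section \<open>Rotations of \<open>A_block\<close> and \<open>B_block\<close>\<close>

text \<open>The rotations of \<open>A\<^sub>m\<close> and \<open>B\<^sub>m\<close> are the cases of nonzero even and of odd offsets.\<close>

definition half_block :: "nat \<Rightarrow> (nat \<Rightarrow> bool) \<Rightarrow> nat \<Rightarrow> point set" where
  "half_block m P q = insert (Inl q) (Inl ` at_offset m P q \<union> Inr ` at_offset m P q)"

lemma half_block_rho:
  assumes "i \<in> {1..m}"
  shows "(rho m ^^ i) ` half_block m P m = half_block m P i"
proof -
  have i: "i \<le> m" "m \<in> {1..m}" "rot m i m = i"
    using assms by (auto simp: rot_def)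
  have "half_block m P m \<subseteq> E m"
    using i(2) by (auto simp: half_block_def E_def at_offset_def)
  from rho_power_image[OF this i(1)] have "(rho m ^^ i) ` half_block m P m =
      insert (Inl i) (Inl ` rot m i ` at_offset m P m \<union> Inr ` rot m i ` at_offset m P m)"
    by (simp add: half_block_def image_Un image_image i(3))
  then show ?thesis
    by (simp only: half_block_def rot_at_offset[OF i(1,2)] i(3))
qed

lemma card_half_block:
  assumes "q \<in> {1..m}" "\<not> P 0"
  shows "half_block m P q \<subseteq> E m" "card (half_block m P q) = Suc (2 * card {t. t < m \<and> P t})"
proof -
  show "half_block m P q \<subseteq> E m"
    using assms(1) by (auto simp: half_block_def E_def at_offset_def)
  have "q \<notin> at_offset m P q" "finite (at_offset m P q)"
    using assms(2) by (auto simp: at_offset_def offset_def)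
  then have "card (half_block m P q) = Suc (card (Inl ` at_offset m P q \<union> Inr ` at_offset m P q :: point set))"
    unfolding half_block_def by (intro card_insert_disjoint) auto
  also have "card (Inl ` at_offset m P q \<union> Inr ` at_offset m P q :: point set) = 2 * card (at_offset m P q)"
    using \<open>finite (at_offset m P q)\<close> by (subst card_Un_disjoint) (auto simp: card_image)
  finally show "card (half_block m P q) = Suc (2 * card {t. t < m \<and> P t})"
    using card_at_offset[OF assms(1)] by simp
qed

lemma swap_half_block:
  assumes "\<not> P 0"
  shows "swap q ` half_block m P q = insert (Inr q) (Inl ` at_offset m P q \<union> Inr ` at_offset m P q)"
proof -
  let ?D = "Inl ` at_offset m P q \<union> Inr ` at_offset m P q :: point set"
  have "swap q ` ?D = ?D"
    by (rule transpose_image_eq) auto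
  then show ?thesis
    unfolding half_block_def image_insert by simp
qed

lemma swap_half_block_other:
  assumes "r \<noteq> q"
  shows "swap q ` half_block m P r = half_block m P r"
  using assms by (intro transpose_image_eq) (auto simp: half_block_def)

section \<open>The blocks of \<open>H_system\<close> and the Sperner property\<close>

context
  fixes m :: nat
  assumes odd_m: "odd m" and m_ge_3: "3 \<le> m"
begin

text \<open>Counted from \<open>m\<close>, a point \<open>p < m\<close> has offset \<open>p\<close>,
  and \<open>m\<close> itself has offset 0. As \<open>m\<close> is odd, the odd numbers below
  \<open>m\<close> end at \<open>m - 2\<close>.\<close>

lemma C_set_eq: "C_set m = at_offset m odd m"
  using odd_m by (auto simp: C_set_def at_offset_def offset_def elim!: oddE)

lemma shift_C_set_eq: "shift m (C_set m) 1 = at_offset m (\<lambda>t. even t \<and> t \<noteq> 0) m"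
proof -
  have "addm m x 1 = x + 1" if "x \<in> C_set m" for x
    using that by (auto simp: addm_def C_set_def)
  then have "shift m (C_set m) 1 = (\<lambda>x. x + 1) ` C_set m"
    unfolding shift_def by (intro image_cong) auto
  also have "\<dots> = at_offset m (\<lambda>t. even t \<and> t \<noteq> 0) m"
  proof
    show "(\<lambda>x. x + 1) ` C_set m \<subseteq> at_offset m (\<lambda>t. even t \<and> t \<noteq> 0) m"
      using odd_m by (auto simp: C_set_def at_offset_def offset_def)
    show "at_offset m (\<lambda>t. even t \<and> t \<noteq> 0) m \<subseteq> (\<lambda>x. x + 1) ` C_set m"
    proof
      fix p assume "p \<in> at_offset m (\<lambda>t. even t \<and> t \<noteq> 0) m"
      then have "p < m" "even p" "0 < p"
        using odd_m by (auto simp: at_offset_def offset_def split: if_splits)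
      moreover from this have "Suc p \<noteq> m + 1" "p - 1 + 2 \<le> m" by simp_all
      ultimately have "p - 1 \<in> C_set m" "p = p - 1 + 1"
        by (simp_all add: C_set_def)
      then show "p \<in> (\<lambda>x. x + 1) ` C_set m" by (rule rev_image_eqI)
    qed
  qed
  finally show ?thesis .
qed

lemma card_odd_below: "card {t. t < m \<and> odd t} = m div 2"
proof -
  have "{t. t < m \<and> odd t} = (\<lambda>k. 2 * k + 1) ` {..<m div 2}"
    using odd_m by (auto elim!: oddE)
  then show ?thesis by (simp add: card_image inj_on_def)
qed

lemma card_even_below: "card {t. t < m \<and> even t \<and> t \<noteq> 0} = m div 2"
proof -
  have "{t. t < m \<and> even t \<and> t \<noteq> 0} = Suc ` {t. t < m \<and> odd t}"
  proof
    show "{t. t < m \<and> even t \<and> t \<noteq> 0} \<subseteq> Suc ` {t. t < m \<and> odd t}"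
    proof
      fix t assume "t \<in> {t. t < m \<and> even t \<and> t \<noteq> 0}"
      then have "t - 1 \<in> {t. t < m \<and> odd t}" "t = Suc (t - 1)" by auto
      then show "t \<in> Suc ` {t. t < m \<and> odd t}" by (rule rev_image_eqI)
    qed
    have "Suc t \<noteq> m" if "odd t" for t using odd_m that by auto
    then show "Suc ` {t. t < m \<and> odd t} \<subseteq> {t. t < m \<and> even t \<and> t \<noteq> 0}"
      by (auto simp: Suc_lessI)
  qed
  then show ?thesis using card_odd_below by (simp add: card_image)
qed

lemma cyc_blocks:
  assumes "S \<in> cyc m {A_block m, B_block m}"
  obtains q where "q \<in> {1..m}" "S = half_block m (\<lambda>t. even t \<and> t \<noteq> 0) q \<or> S = half_block m odd q"
proof -
  have "A_block m = half_block m (\<lambda>t. even t \<and> t \<noteq> 0) m" "B_block m = half_block m odd m"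
    unfolding A_block_def B_block_def half_block_def shift_C_set_eq unfolding C_set_eq by simp_all
  with assms show thesis
    using half_block_rho that by (auto simp: cyc_def)
qed

text \<open>The case \<open>angle\<close> retains that the whole orbit lies in
  \<open>H_system\<close>, so that exchanges applied to \<open>S\<close> stay inside it.\<close>

lemma H_cases:
  assumes "S \<in> H_system m"
  obtains (half) q where "q \<in> {1..m}"
      "S = half_block m (\<lambda>t. even t \<and> t \<noteq> 0) q \<or> S = half_block m odd q"
  | (angle) X Y where "S \<in> angle m X Y" "angle m X Y \<subseteq> H_system m"
      "X \<subseteq> {1..m}" "Y \<subseteq> {1..m}" "X \<inter> Y = {}" "card X = card Y"
proof (cases "S \<in> cyc m {A_block m, B_block m}")
  case True
  then show thesis by (rule cyc_blocks) (rule half)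
next
  case False
  then obtain Q where Q: "S \<in> Q" "Q \<in> Omega m" "Q \<subseteq> H_system m"
    using assms unfolding H_system_def by blast
  then obtain X Y where "Q = angle m X Y" "X \<subseteq> {1..m}" "Y \<subseteq> {1..m}" "X \<inter> Y = {}" "card X = card Y"
    unfolding Omega_def by blast
  with Q show thesis using angle by blast
qed

lemma H_card:
  assumes "S \<in> H_system m"
  shows "S \<subseteq> E m \<and> card S = m"
  using assms
proof (cases rule: H_cases)
  case (half q)
  have m: "Suc (2 * (m div 2)) = m" using odd_m by simp
  have *: "half_block m P q \<subseteq> E m \<and> card (half_block m P q) = m"
    if "\<not> P 0" "card {t. t < m \<and> P t} = m div 2" for P
    using card_half_block[where P = P, OF half(1) that(1)] unfolding that(2) m by blast
  from half(2) show ?thesis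
  proof
    assume S: "S = half_block m (\<lambda>t. even t \<and> t \<noteq> 0) q"
    show ?thesis unfolding S using card_even_below by (intro *) blast+
  next
    assume S: "S = half_block m odd q"
    show ?thesis unfolding S using card_odd_below by (intro *) simp_all
  qed
next
  case (angle X Y)
  from angle_card[OF angle(1,3-6)] show ?thesis by blast
qed

text \<open>All blocks have exactly \<open>m\<close> points, so inclusion between two of them forces
  equality.\<close>

lemma sperner_H_F_parity: "sperner_system (E m) (H_system m \<union> F_parity m e)"
proof -
  have *: "S \<subseteq> E m" "card S = m" if "S \<in> H_system m \<union> F_parity m e" for S
    using that H_card F_block_card by blast+
  have "finite (E m)" by (simp add: E_def)
  moreover have "S = T" if "S \<in> H_system m \<union> F_parity m e" "T \<in> H_system m \<union> F_parity m e" "S \<subseteq> T" for S T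
    using that * finite_subset[OF _ \<open>finite (E m)\<close>] by (intro card_subset_eq) auto
  ultimately show ?thesis
    unfolding sperner_system_def set_system_def using * by blast
qed

section \<open>Blocks below the enlarged exceptional blocks\<close>

text \<open>The parities in \<open>D\<close> give signature \<beta>. The bound \<open>0 < k\<close>
  separates the orbit from that of the empty pair, and \<open>k < m div 2\<close> separates it from
  the two orbits removed in \<open>H_system\<close>, since \<open>C_set m\<close> and its shift have
  \<open>m div 2\<close> elements.\<close>

lemma bracket_subset_H:
  assumes q: "q \<in> {1..m}" and disj: "\<And>t. P t \<Longrightarrow> \<not> R t"
    and card: "card {t. t < m \<and> P t} = k" "card {t. t < m \<and> R t} = k" "0 < k" "k < m div 2"
    and D: "\<And>t. t < m \<Longrightarrow> P t \<Longrightarrow> D t = Let_x" "\<And>t. t < m \<Longrightarrow> R t \<Longrightarrow> D t = Let_y"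
      "\<And>t. t < m \<Longrightarrow> \<not> P t \<Longrightarrow> \<not> R t \<Longrightarrow>
      (let u = (if t = 0 then m - 1 else t - 1)
       in D t \<in> {Let_alpha, Let_beta} \<and> D t \<noteq> D u \<and> (P u \<longrightarrow> D t = Let_beta) \<and> (R u \<longrightarrow> D t = Let_alpha))"
    and parity: "even (card {t. t < m \<and> D t = Let_alpha})" "odd (card {t. t < m \<and> D t = Let_beta})"
  shows "bracket m (at_offset m P q) (at_offset m R q) \<subseteq> H_system m"
proof -
  let ?X = "at_offset m P q" and ?Y = "at_offset m R q"
  have m1: "1 \<le> m" using m_ge_3 by simp
  have XY: "?X \<subseteq> {1..m}" "?Y \<subseteq> {1..m}" "?X \<inter> ?Y = {}"
    using disj by (auto simp: at_offset_def)
  have card_XY: "card ?X = k" "card ?Y = k"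
    using card card_at_offset[OF q] by simp_all
  have "{t. t < m \<and> P t} \<noteq> {}" using card(1,3) by (metis card.empty less_irrefl)
  then have ne: "\<exists>t<m. P t \<or> R t" by blast
  \<comment> \<open>All base points \<open>r\<close> are covered because \<open>sgn_angle\<close>
    quantifies over every pair representing the orbit, and these pairs are rotations of one
    another.\<close>
  have sig: "signature m (at_offset m P r) (at_offset m R r) = {Let_beta}" if "r \<in> {1..m}" for r
  proof -
    have "signature m (at_offset m P r) (at_offset m R r) =
        {e \<in> {Let_alpha, Let_beta}. odd (card {t. t < m \<and> D t = e})}"
      by (rule signature_at_offset) (fact that ne disj D)+
    with parity show ?thesis by auto
  qed
  have card_eq: "card X' = k" if "angle m ?X ?Y = angle m X' Y'" "X' \<subseteq> {1..m}" "Y' \<subseteq> {1..m}" "X' \<inter> Y' = {}" for X' Y'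
  proof -
    from angle_eqD[OF m1 that(1) XY that(2-4)] obtain i where "i \<le> m" "X' = rot m i ` ?X" .
    then show ?thesis
      using card_XY card_image[OF inj_on_subset[OF bij_betw_imp_inj_on[OF bij_betw_rot] XY(1)]] by simp
  qed
  have "sgn_angle m (angle m ?X ?Y) = {Let_beta}"
    unfolding sgn_angle_def
  proof (rule the_equality)
    have "?X \<noteq> {}" using card_XY card(3) by auto
    then show "\<exists>X Y. X \<subseteq> {1..m} \<and> Y \<subseteq> {1..m} \<and> X \<inter> Y = {} \<and> (X, Y) \<noteq> ({}, {}) \<and>
        angle m ?X ?Y = angle m X Y \<and> {Let_beta} = signature m X Y"
      using XY sig[OF q] by (intro exI[of _ ?X] exI[of _ ?Y]) simp
  next
    fix s assume "\<exists>X Y. X \<subseteq> {1..m} \<and> Y \<subseteq> {1..m} \<and> X \<inter> Y = {} \<and> (X, Y) \<noteq> ({}, {}) \<and>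
        angle m ?X ?Y = angle m X Y \<and> s = signature m X Y"
    then obtain X' Y' where X': "X' \<subseteq> {1..m}" "Y' \<subseteq> {1..m}" "X' \<inter> Y' = {}"
        "angle m ?X ?Y = angle m X' Y'" "s = signature m X' Y'"
      by blast
    from angle_eqD[OF m1 X'(4) XY X'(1-3)] obtain i where
      i: "i \<le> m" "X' = rot m i ` ?X" "Y' = rot m i ` ?Y" .
    have "rot m i q \<in> {1..m}" using bij_betwE[OF bij_betw_rot[OF i(1)]] q by blast
    with sig show "s = {Let_beta}"
      unfolding X'(5) i(2,3) rot_at_offset[OF i(1) q] .
  qed
  moreover have "angle m ?X ?Y \<in> Omega m"
  proof -
    have "angle m ?X ?Y \<noteq> angle m {} {}"
      using card_eq[of "{}" "{}"] card(3) by auto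
    then show ?thesis
      unfolding Omega_def using XY card_XY
      by (intro DiffI CollectI exI[of _ ?X] exI[of _ ?Y]) simp_all
  qed
  moreover have "angle m ?X ?Y \<noteq> angle m (C_set m) (shift m (C_set m) 1)"
    "angle m ?X ?Y \<noteq> angle m (shift m (C_set m) 1) (C_set m)"
  proof -
    have m: "m \<in> {1..m}" using m1 by simp
    have C: "card (C_set m) = m div 2" "card (shift m (C_set m) 1) = m div 2"
      unfolding shift_C_set_eq unfolding C_set_eq card_at_offset[OF m]
      by (rule card_odd_below card_even_below)+
    have sub: "C_set m \<subseteq> {1..m}" "shift m (C_set m) 1 \<subseteq> {1..m}" "C_set m \<inter> shift m (C_set m) 1 = {}"
      unfolding shift_C_set_eq unfolding C_set_eq by (auto simp: at_offset_def)
    show "angle m ?X ?Y \<noteq> angle m (C_set m) (shift m (C_set m) 1)"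
    proof
      assume "angle m ?X ?Y = angle m (C_set m) (shift m (C_set m) 1)"
      from card_eq[OF this sub] C card(4) show False by simp
    qed
    show "angle m ?X ?Y \<noteq> angle m (shift m (C_set m) 1) (C_set m)"
    proof
      assume "angle m ?X ?Y = angle m (shift m (C_set m) 1) (C_set m)"
      from card_eq[OF this sub(2,1)] sub(3) C card(4) show False by (simp add: Int_commute)
    qed
  qed
  ultimately have "angle m ?X ?Y \<subseteq> H_system m"
    unfolding H_system_def by blast
  then show ?thesis
    using bracket_subset_angle[OF m1] by blast
qed

text \<open>In the first case, which occurs only for \<open>m = 3\<close>, the two transversals contained in \<open>U\<close> that
  differ at \<open>p\<close> lie in different \<open>\<F>\<^sub>i\<close>.\<close>

lemma dominated:
  assumes p: "p \<in> {1..m}" "Inl p \<in> U" "Inr p \<in> U" and U: "U - {Inl p} \<in> bracket m X Y"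
    and XY: "X = {} \<and> Y = {} \<or> bracket m X Y \<subseteq> H_system m"
  shows "\<exists>T\<in>H_system m \<union> F_parity m e. T \<subseteq> U"
  using XY
proof
  assume "X = {} \<and> Y = {}"
  then obtain e' where e': "U - {Inl p} \<in> F_parity m e'"
    using U bracket_empty_F_parity by blast
  have "swap p ` U = U" using p by (intro transpose_image_eq) simp
  then have sub: "swap p ` (U - {Inl p}) \<subseteq> U" by blast
  from swap_F_parity[OF e' p(1)] e' have "U - {Inl p} \<in> F_parity m e \<or> swap p ` (U - {Inl p}) \<in> F_parity m e"
    by (cases e; cases e') simp_all
  with sub show ?thesis by blast
next
  assume "bracket m X Y \<subseteq> H_system m"
  with U show ?thesis by blast
qed

text \<open>The exchanged block doubles the nonzero even offsets and contains the primed point at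
  offset 0. Adding \<open>a\<close> makes offset 1 a single, and dropping one point at offset
  \<open>m - 1\<close> turns that double into a single. There remain as many doubles as missing
  positions, and three singles at the consecutive offsets \<open>m - 1\<close>, 0, 1.\<close>

lemma even_half_dominated:
  assumes q: "q \<in> {1..m}" and a: "a \<in> {Inl i, Inr i}" "i \<in> {1..m}" "offset m q i = 1"
  shows "\<exists>T\<in>H_system m \<union> F_parity m e. T \<subseteq> insert a (swap q ` half_block m (\<lambda>t. even t \<and> t \<noteq> 0) q)"
proof -
  let ?even = "\<lambda>t::nat. even t \<and> t \<noteq> 0"
  let ?P = "\<lambda>t. even t \<and> t \<noteq> 0 \<and> t \<noteq> m - 1" and ?R = "\<lambda>t. odd t \<and> t \<noteq> 1"
  let ?X = "at_offset m ?P q" and ?Y = "at_offset m ?R q"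
  have "m - 1 \<in> offset m q ` {1..m}"
    using bij_betw_imp_surj_on[OF bij_betw_offset[OF q]] m_ge_3 by simp
  then obtain p where p: "p \<in> {1..m}" "offset m q p = m - 1" by auto
  note inj = inj_on_eq_iff[OF bij_betw_imp_inj_on[OF bij_betw_offset[OF q]]]
  define U where "U = insert a (swap q ` half_block m ?even q)"
  have U: "U = insert a (insert (Inr q) (Inl ` at_offset m ?even q \<union> Inr ` at_offset m ?even q))"
    unfolding U_def by (subst swap_half_block) simp_all
  have q0: "offset m q x = 0 \<longleftrightarrow> x = q" and i1: "offset m q x = 1 \<longleftrightarrow> x = i"
    and pm: "offset m q x = m - 1 \<longleftrightarrow> x = p" if "x \<in> {1..m}" for x
    using inj[OF that q] inj[OF that a(2)] inj[OF that p(1)] unfolding a(3) p(2) by (simp_all add: offset_def)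
  have "p \<in> at_offset m ?even q"
    using p odd_m m_ge_3 by (simp add: at_offset_def)
  then have pU: "Inl p \<in> U" "Inr p \<in> U" by (auto simp: U)
  have ne: "i \<noteq> p" "i \<noteq> q" "p \<noteq> q"
    using a p m_ge_3 by (auto simp: offset_def)
  have XY: "?X = at_offset m ?even q - {p}" "?Y = {x \<in> {1..m}. odd (offset m q x)} - {i}"
    using pm i1 by (auto simp: at_offset_def)
  have "U - {Inl p} \<in> bracket m ?X ?Y"
  proof (subst bracket_iff)
    show "U - {Inl p} \<subseteq> E m \<and> doubles (U - {Inl p}) = ?X \<and> missing m (U - {Inl p}) = ?Y"
    proof (intro conjI)
      show "U - {Inl p} \<subseteq> E m"
        using a q by (auto simp: U E_def at_offset_def)
      have qq: "even (offset m q q)" by (simp add: offset_def)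
      have "i \<notin> at_offset m ?even q" "q \<notin> at_offset m ?even q"
        using a(3) q0[OF q] by (auto simp: at_offset_def)
      then show "doubles (U - {Inl p}) = ?X"
        unfolding XY doubles_def U using a(1) ne by auto
      show "missing m (U - {Inl p}) = ?Y"
        unfolding XY missing_def U using a(1) ne q0 qq \<open>p \<in> at_offset m ?even q\<close>
        by (auto simp: at_offset_def)
    qed
  qed (auto simp: at_offset_def)
  moreover have "?X = {} \<and> ?Y = {} \<or> bracket m ?X ?Y \<subseteq> H_system m"
  proof (cases "m = 3")
    case True
    \<comment> \<open>For \<open>m = 3\<close> the offsets \<open>m - 1 = 2\<close> and 1 exhaust
      the candidates for \<open>?P\<close> and \<open>?R\<close>, so both sets are empty.\<close>
    have "offset m q x < 3" if "x \<in> {1..m}" for x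
      using that q True by (auto simp: offset_def)
    then have "offset m q x \<in> {0, 1, 2}" if "x \<in> {1..m}" for x
      using that by fastforce
    then show ?thesis using True by (fastforce simp: at_offset_def)
  next
    case False
    then have m5: "m \<ge> 5" using odd_m m_ge_3 by presburger
    \<comment> \<open>Since \<open>m \<ge> 5\<close>, offset \<open>m - 2\<close> differs from 1 and
      carries \<open>y\<close>. This forces \<alpha> at \<open>m - 1\<close>, and alternation gives
      \<beta> at 0 and \<alpha> at 1: two \<alpha> and one \<beta>.\<close>
    let ?D = "\<lambda>t. if t = 0 then Let_beta else if t = 1 \<or> t = m - 1 then Let_alpha
      else if even t then Let_x else Let_y"
    have "bracket m ?X ?Y \<subseteq> H_system m"
    proof (rule bracket_subset_H[where D = ?D and k = "m div 2 - 1"])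
      have "{t. t < m \<and> ?P t} = {t. t < m \<and> even t \<and> t \<noteq> 0} - {m - 1}" by auto
      then show "card {t. t < m \<and> ?P t} = m div 2 - 1"
        using card_even_below odd_m m_ge_3 by simp
      have "{t. t < m \<and> ?R t} = {t. t < m \<and> odd t} - {1}" by auto
      then show "card {t. t < m \<and> ?R t} = m div 2 - 1"
        using card_odd_below m_ge_3 by simp
      show "0 < m div 2 - 1" "m div 2 - 1 < m div 2" using m5 by simp_all
      have "{t. t < m \<and> ?D t = Let_alpha} = {1, m - 1}"
        using m5 by (auto split: if_splits)
      then show "even (card {t. t < m \<and> ?D t = Let_alpha})"
        using m5 by simp
      have "{t. t < m \<and> ?D t = Let_beta} = {0}"
        using m5 by (auto split: if_splits)
      then show "odd (card {t. t < m \<and> ?D t = Let_beta})" by simp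
      show "?D t = Let_y" if "t < m" "?R t" for t
      proof -
        have "t \<noteq> 0" "t \<noteq> m - 1" using that odd_m by (auto simp: odd_pos)
        with that show ?thesis by simp
      qed
      fix t assume "t < m" "\<not> ?P t" "\<not> ?R t"
      then have "t = 0 \<or> t = 1 \<or> t = m - 1" by auto
      moreover have "odd (m - 1 - 1)" "m - 1 - 1 \<noteq> 1" "m - 1 - 1 \<noteq> 0" "m - 1 - 1 \<noteq> m - 1" "m - 1 \<noteq> 1"
        using m5 odd_m by auto
      ultimately show "let u = if t = 0 then m - 1 else t - 1
         in ?D t \<in> {Let_alpha, Let_beta} \<and> ?D t \<noteq> ?D u \<and>
            (?P u \<longrightarrow> ?D t = Let_beta) \<and> (?R u \<longrightarrow> ?D t = Let_alpha)"
        using m5 by (elim disjE) (simp_all add: Let_def)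
    qed (use q in auto)
    then show ?thesis ..
  qed
  ultimately show ?thesis
    using dominated[OF p(1) pU] unfolding U_def by blast
qed

text \<open>The exchanged block doubles the odd offsets and contains the primed point at offset 0.
  Adding \<open>b\<close> makes its even offset \<open>v\<close> a single, and dropping one point at
  offset \<open>m - 2\<close> makes that position a single. The singles 0, \<open>v\<close>,
  \<open>m - 2\<close> need not be consecutive, but their letters do not depend on
  \<open>v\<close>.\<close>

lemma odd_half_dominated:
  assumes q: "q \<in> {1..m}" and b: "b \<in> {Inl j, Inr j}" "j \<in> {1..m}" "even (offset m q j)" "offset m q j \<noteq> 0"
  shows "\<exists>T\<in>H_system m \<union> F_parity m e. T \<subseteq> insert b (swap q ` half_block m odd q)"
proof -
  define v where "v = offset m q j"
  have v: "even v" "v \<noteq> 0" "v < m"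
    using b q by (auto simp: v_def offset_def)
  let ?P = "\<lambda>t. odd t \<and> t \<noteq> m - 2" and ?R = "\<lambda>t. even t \<and> t \<noteq> 0 \<and> t \<noteq> v"
  let ?X = "at_offset m ?P q" and ?Y = "at_offset m ?R q"
  have "m - 2 \<in> offset m q ` {1..m}"
    using bij_betw_imp_surj_on[OF bij_betw_offset[OF q]] m_ge_3 by simp
  then obtain p where p: "p \<in> {1..m}" "offset m q p = m - 2" by auto
  note inj = inj_on_eq_iff[OF bij_betw_imp_inj_on[OF bij_betw_offset[OF q]]]
  define U where "U = insert b (swap q ` half_block m odd q)"
  have U: "U = insert b (insert (Inr q) (Inl ` at_offset m odd q \<union> Inr ` at_offset m odd q))"
    unfolding U_def by (subst swap_half_block) simp_all
  have q0: "offset m q x = 0 \<longleftrightarrow> x = q" and jv: "offset m q x = v \<longleftrightarrow> x = j"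
    and pm: "offset m q x = m - 2 \<longleftrightarrow> x = p" if "x \<in> {1..m}" for x
    using inj[OF that q] inj[OF that b(2)] inj[OF that p(1)] unfolding v_def p(2) by (simp_all add: offset_def)
  have odd_p: "odd (m - 2)" using odd_m m_ge_3 by simp
  have "p \<in> at_offset m odd q"
    using p odd_p by (simp add: at_offset_def)
  then have pU: "Inl p \<in> U" "Inr p \<in> U" by (auto simp: U)
  have ne: "j \<noteq> p" "j \<noteq> q" "p \<noteq> q"
    using b p odd_p by (auto simp: offset_def)
  have "offset m q q = 0" by (simp add: offset_def)
  then have XY: "?X = at_offset m odd q - {p}" "?Y = {x \<in> {1..m}. even (offset m q x)} - {j, q}"
    using pm jv q0 by (auto simp: at_offset_def)
  have "U - {Inl p} \<in> bracket m ?X ?Y"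
  proof (subst bracket_iff)
    show "U - {Inl p} \<subseteq> E m \<and> doubles (U - {Inl p}) = ?X \<and> missing m (U - {Inl p}) = ?Y"
    proof (intro conjI)
      show "U - {Inl p} \<subseteq> E m"
        using b q by (auto simp: U E_def at_offset_def)
      have "j \<notin> at_offset m odd q" "q \<notin> at_offset m odd q"
        using b(3) q0[OF q] by (auto simp: at_offset_def offset_def)
      then show "doubles (U - {Inl p}) = ?X"
        unfolding XY doubles_def U using b(1) ne by auto
      show "missing m (U - {Inl p}) = ?Y"
        unfolding XY missing_def U using b(1) ne \<open>p \<in> at_offset m odd q\<close>
        by (auto simp: at_offset_def)
    qed
  qed (auto simp: at_offset_def)
  moreover have "?X = {} \<and> ?Y = {} \<or> bracket m ?X ?Y \<subseteq> H_system m"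
  proof (cases "m = 3")
    case True
    \<comment> \<open>For \<open>m = 3\<close>, \<open>v = 2\<close> and \<open>m - 2 = 1\<close>
      again exhaust the nonzero offsets.\<close>
    have "v = 2" using v True by presburger
    have "offset m q x < 3" if "x \<in> {1..m}" for x
      using that q True by (auto simp: offset_def)
    then have "offset m q x \<in> {0, 1, 2}" if "x \<in> {1..m}" for x
      using that by fastforce
    then show ?thesis using True \<open>v = 2\<close> by (fastforce simp: at_offset_def)
  next
    case False
    then have m5: "m \<ge> 5" using odd_m m_ge_3 by presburger
    \<comment> \<open>The predecessor of \<open>v\<close> is a double, or the single
      \<open>m - 2\<close> if \<open>v = m - 1\<close>; both are compatible with \<beta> at
      \<open>v\<close>. The predecessors of 0 and of \<open>m - 2\<close> are missing positions or
      \<open>v\<close> itself, which fits \<alpha>. The bound \<open>m \<ge> 5\<close> keeps the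
      predecessor of \<open>m - 2\<close> away from 0.\<close>
    let ?D = "\<lambda>t. if t = v then Let_beta else if t = 0 \<or> t = m - 2 then Let_alpha
      else if odd t then Let_x else Let_y"
    have vm: "v \<noteq> m - 2" using v odd_p by auto
    have "bracket m ?X ?Y \<subseteq> H_system m"
    proof (rule bracket_subset_H[where D = ?D and k = "m div 2 - 1"])
      have "{t. t < m \<and> ?P t} = {t. t < m \<and> odd t} - {m - 2}" by auto
      then show "card {t. t < m \<and> ?P t} = m div 2 - 1"
        using card_odd_below odd_p m_ge_3 by simp
      have "{t. t < m \<and> ?R t} = {t. t < m \<and> even t \<and> t \<noteq> 0} - {v}" by auto
      then show "card {t. t < m \<and> ?R t} = m div 2 - 1"
        using card_even_below v by simp
      show "0 < m div 2 - 1" "m div 2 - 1 < m div 2" using m5 by simp_all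
      have "{t. t < m \<and> ?D t = Let_alpha} = {0, m - 2}"
        using m5 v vm by (auto split: if_splits)
      then show "even (card {t. t < m \<and> ?D t = Let_alpha})"
        using m5 by simp
      have "{t. t < m \<and> ?D t = Let_beta} = {v}"
        using v by (auto split: if_splits)
      then show "odd (card {t. t < m \<and> ?D t = Let_beta})" by simp
      show "?D t = Let_y" if "t < m" "?R t" for t
        using that odd_p by auto
      fix t assume "t < m" "\<not> ?P t" "\<not> ?R t"
      then have "t = 0 \<or> t = m - 2 \<or> t = v" by auto
      moreover have "even (m - 1)" "even (m - 2 - 1)" "m - 1 \<noteq> m - 2" "m - 2 - 1 \<noteq> m - 2"
        "m - 2 - 1 \<noteq> 0" "m - 1 \<noteq> 0" "m - 2 \<noteq> 0" "odd (v - 1)" "v - 1 \<noteq> v" "v - 1 \<noteq> 0"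
        using m5 odd_m v by auto
      ultimately show "let u = if t = 0 then m - 1 else t - 1
         in ?D t \<in> {Let_alpha, Let_beta} \<and> ?D t \<noteq> ?D u \<and>
            (?P u \<longrightarrow> ?D t = Let_beta) \<and> (?R u \<longrightarrow> ?D t = Let_alpha)"
        using m5 v vm by (elim disjE) (simp_all add: Let_def)
    qed (use q v in \<open>auto simp: odd_pos\<close>)
    then show ?thesis ..
  qed
  ultimately show ?thesis
    using dominated[OF p(1) pU] unfolding U_def by blast
qed

section \<open>The exchange as an isomorphism modulo \<open>theta\<close>\<close>

text \<open>Only the two half blocks based at \<open>q\<close> need an argument. The even one
  contains \<open>b\<close> and the odd one contains \<open>a\<close>, also after the exchange. The
  other element of the pair is therefore free modulo \<open>theta\<close>, and adding it uncovers a
  block of the target system.\<close>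

lemma swap_dominated:
  assumes q: "q \<in> {1..m}" and a: "a \<in> {Inl i, Inr i}" "i \<in> {1..m}" "offset m q i = 1"
    and b: "b \<in> {Inl j, Inr j}" "j \<in> {1..m}" "even (offset m q j)" "offset m q j \<noteq> 0"
    and S: "S \<in> H_system m \<union> F_parity m e"
  shows "\<exists>T\<in>H_system m \<union> F_parity m (\<not> e).
    T \<subseteq> swap q ` S \<or> T \<subseteq> swap q ` S \<union> {a, b} \<and> swap q ` S \<inter> {a, b} \<noteq> {}"
proof (cases "S \<in> F_parity m e")
  case True
  then show ?thesis using swap_F_parity q by blast
next
  case False
  then have "S \<in> H_system m" using S by blast
  then show ?thesis
  proof (cases rule: H_cases)
    case (half r)
    show ?thesis
    proof (cases "r = q")
      case False
      then have "swap q ` S = S" using half swap_half_block_other by blast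
      with \<open>S \<in> H_system m\<close> show ?thesis by blast
    next
      case True
      with half(2) consider (even) "S = half_block m (\<lambda>t. even t \<and> t \<noteq> 0) q" | (odd) "S = half_block m odd q"
        by blast
      then show ?thesis
      proof cases
        case even
        have "b \<in> swap q ` S"
          unfolding even using b by (subst swap_half_block) (auto simp: at_offset_def)
        moreover obtain T where "T \<in> H_system m \<union> F_parity m (\<not> e)" "T \<subseteq> insert a (swap q ` S)"
          using even_half_dominated[OF q a] unfolding even by blast
        ultimately show ?thesis by blast
      next
        case odd
        have "a \<in> swap q ` S"
          unfolding odd using a by (subst swap_half_block) (auto simp: at_offset_def)
        moreover obtain T where "T \<in> H_system m \<union> F_parity m (\<not> e)" "T \<subseteq> insert b (swap q ` S)"
          using odd_half_dominated[OF q b] unfolding odd by blast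
        ultimately show ?thesis by blast
      qed
    qed
  next
    case (angle X Y)
    then show ?thesis using angle_swap[OF angle(1) q angle(3-5)] by blast
  qed
qed

text \<open>The two cyclic arcs between \<open>i\<close> and \<open>j\<close> have lengths adding up
  to the odd number \<open>m\<close>, so exactly one is odd. Take \<open>q\<close> just before the
  start of the odd arc. The end of the arc then has even offset, at most \<open>m - 1\<close>, so it
  does not wrap around to 0.\<close>

lemma exists_offset_one_even:
  assumes "i \<in> {1..m}" "j \<in> {1..m}" "i < j"
  obtains q where "q \<in> {1..m}" "offset m q i = 1" "even (offset m q j)" "offset m q j \<noteq> 0"
  | q where "q \<in> {1..m}" "offset m q j = 1" "even (offset m q i)" "offset m q i \<noteq> 0"
proof (cases "odd (j - i)")
  case True
  have "cpred m i \<in> {1..m}" "offset m (cpred m i) i = 1"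
    "even (offset m (cpred m i) j)" "offset m (cpred m i) j \<noteq> 0"
    using assms odd_m True by (auto simp: cpred_def offset_def)
  then show thesis by (rule that(1))
next
  case False
  \<comment> \<open>Otherwise \<open>cpred m j\<close> would be \<open>i\<close>, whose offset from
    itself is 0.\<close>
  then have "j - 1 \<noteq> i" using assms by auto
  then have "cpred m j \<in> {1..m}" "offset m (cpred m j) j = 1"
    "even (offset m (cpred m j) i)" "offset m (cpred m j) i \<noteq> 0"
    using assms odd_m False by (auto simp: cpred_def offset_def)
  then show thesis by (rule that(2))
qed

lemma isomorphic_swap:
  assumes q: "q \<in> {1..m}" and a: "a \<in> {Inl i, Inr i}" "i \<in> {1..m}" "offset m q i = 1"
    and b: "b \<in> {Inl j, Inr j}" "j \<in> {1..m}" "even (offset m q j)" "offset m q j \<noteq> 0"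
  shows "isomorphic_systems
    (E m // theta (E m) {a, b}) (identify_min (E m) {a, b} (H_system m \<union> F_parity m e))
    (E m // theta (E m) {a, b}) (identify_min (E m) {a, b} (H_system m \<union> F_parity m (\<not> e)))"
proof (rule isomorphic_identify_min[where \<sigma> = "swap q"])
  let ?I = "{a, b}"
  have "i \<noteq> q" "j \<noteq> q" using a(3) b(4) by (auto simp: offset_def)
  then have fix_I: "swap q a = a" "swap q b = b"
    using a(1) b(1) by (auto simp: transpose_def)
  then show I: "swap q ` ?I = ?I" by simp
  show I_sub: "?I \<subseteq> E m" using a b by (auto simp: E_def)
  show "bij (swap q)" by simp
  show "swap q ` E m = E m"
    using q by (intro transpose_image_eq) (auto simp: E_def)
  have sub: "S \<subseteq> E m" if "S \<in> H_system m \<union> F_parity m e" for S e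
    using that H_card F_block_card by blast
  show "S \<subseteq> E m" if "S \<in> H_system m \<union> F_parity m e" for S
    using that sub by blast
  show "\<exists>T\<in>H_system m \<union> F_parity m (\<not> e). T // theta (E m) ?I \<subseteq> (swap q ` S) // theta (E m) ?I"
    if S: "S \<in> H_system m \<union> F_parity m e" for S
  proof -
    obtain T where T: "T \<in> H_system m \<union> F_parity m (\<not> e)"
      "T \<subseteq> swap q ` S \<or> T \<subseteq> swap q ` S \<union> ?I \<and> swap q ` S \<inter> ?I \<noteq> {}"
      using swap_dominated[OF q a b S] by blast
    show ?thesis
      using quotient_theta_mono[OF I_sub swap_subset_E[OF q sub[OF S]] sub[OF T(1)] T(2)] T(1) by blast
  qed
  show "\<exists>S\<in>H_system m \<union> F_parity m e. (swap q ` S) // theta (E m) ?I \<subseteq> T // theta (E m) ?I"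
    if T: "T \<in> H_system m \<union> F_parity m (\<not> e)" for T
  proof -
    obtain S where S: "S \<in> H_system m \<union> F_parity m e"
      "S \<subseteq> swap q ` T \<or> S \<subseteq> swap q ` T \<union> ?I \<and> swap q ` T \<inter> ?I \<noteq> {}"
      using swap_dominated[OF q a b T] by auto
    \<comment> \<open>Domination was applied to \<open>T\<close> with the parities interchanged. It
      is carried back by the exchange, an involution fixing \<open>a\<close> and
      \<open>b\<close>.\<close>
    have "swap q ` S \<subseteq> T" if "S \<subseteq> swap q ` T"
      using image_mono[OF that, of "swap q"] by (simp only: swap_swap_image)
    moreover have "swap q ` S \<subseteq> T \<union> ?I" if "S \<subseteq> swap q ` T \<union> ?I"
      using image_mono[OF that, of "swap q"] by (simp only: image_Un swap_swap_image I)
    moreover have "T \<inter> ?I \<noteq> {}" if "swap q ` T \<inter> ?I \<noteq> {}"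
      using that fix_I in_transpose_image_iff[of a "Inl q" "Inr q" T] in_transpose_image_iff[of b "Inl q" "Inr q" T]
      by auto
    ultimately have "swap q ` S \<subseteq> T \<or> swap q ` S \<subseteq> T \<union> ?I \<and> T \<inter> ?I \<noteq> {}"
      using S(2) by blast
    from quotient_theta_mono[OF I_sub sub[OF T] swap_subset_E[OF q sub[OF S(1)]] this] S(1)
    show ?thesis by blast
  qed
qed

text \<open>Here \<sigma> is the identity: the exchange at \<open>p\<close> serves only to pass from
  one parity to the other and moves points only within the class
  \<open>{Inl p, Inr p}\<close>.\<close>

lemma isomorphic_mates:
  assumes p: "p \<in> {1..m}"
  shows "isomorphic_systems
    (E m // theta (E m) {Inl p, Inr p}) (identify_min (E m) {Inl p, Inr p} (H_system m \<union> F_parity m e))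
    (E m // theta (E m) {Inl p, Inr p}) (identify_min (E m) {Inl p, Inr p} (H_system m \<union> F_parity m (\<not> e)))"
proof (rule isomorphic_identify_min[where \<sigma> = id])
  let ?I = "{Inl p, Inr p} :: point set"
  show I_sub: "?I \<subseteq> E m" using p by (auto simp: E_def)
  have sub: "S \<subseteq> E m" if "S \<in> H_system m \<union> F_parity m e" for S e
    using that H_card F_block_card by blast
  show "S \<subseteq> E m" if "S \<in> H_system m \<union> F_parity m e" for S
    using that sub by blast
  have dom: "\<exists>T\<in>H_system m \<union> F_parity m (\<not> e). T // theta (E m) ?I \<subseteq> S // theta (E m) ?I"
    if S: "S \<in> H_system m \<union> F_parity m e" for S e
  proof (cases "S \<in> H_system m")
    case True
    then show ?thesis by blast
  next
    case False
    then have F: "S \<in> F_parity m e" using S by blast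
    \<comment> \<open>If \<open>S\<close> misses the pair, the exchange fixes \<open>S\<close>;
      otherwise its image stays within \<open>S \<union> ?I\<close>.\<close>
    have "swap p ` S \<subseteq> S \<or> swap p ` S \<subseteq> S \<union> ?I \<and> S \<inter> ?I \<noteq> {}"
      by (auto simp: transpose_def)
    from quotient_theta_mono[OF I_sub sub[OF S] swap_subset_E[OF p sub[OF S]] this]
    show ?thesis using swap_F_parity[OF F p] by blast
  qed
  show "\<exists>T\<in>H_system m \<union> F_parity m (\<not> e). T // theta (E m) ?I \<subseteq> (id ` S) // theta (E m) ?I"
    if "S \<in> H_system m \<union> F_parity m e" for S
    using dom[OF that] by simp
  show "\<exists>S\<in>H_system m \<union> F_parity m e. (id ` S) // theta (E m) ?I \<subseteq> T // theta (E m) ?I"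
    if "T \<in> H_system m \<union> F_parity m (\<not> e)" for T
    using dom[OF that] by simp
qed simp_all

lemma isomorphic_pair:
  assumes "I \<subseteq> E m" "card I = 2"
  shows "isomorphic_systems
    (E m // theta (E m) I) (identify_min (E m) I (H_system m \<union> F_parity m e))
    (E m // theta (E m) I) (identify_min (E m) I (H_system m \<union> F_parity m (\<not> e)))"
proof -
  obtain a b where I: "I = {a, b}" "a \<noteq> b"
    using assms(2) by (auto simp: card_2_iff)
  obtain i where i: "a \<in> {Inl i, Inr i}" "i \<in> {1..m}"
    using assms(1) I by (auto simp: E_def)
  obtain j where j: "b \<in> {Inl j, Inr j}" "j \<in> {1..m}"
    using assms(1) I by (auto simp: E_def)
  \<comment> \<open>Which of \<open>a\<close> and \<open>b\<close> gets offset 1 depends on parity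
    as well as on the order of \<open>i\<close> and \<open>j\<close>, so each strict case splits
    once more.\<close>
  consider "i = j" | "i < j" | "j < i" by linarith
  then show ?thesis
  proof cases
    case 1
    then have "I = {Inl i, Inr i}" using I i j by auto
    then show ?thesis using isomorphic_mates[OF i(2)] by simp
  next
    case 2
    with i(2) j(2) show ?thesis
    proof (cases rule: exists_offset_one_even)
      case (1 q)
      from isomorphic_swap[OF 1(1) i 1(2) j 1(3,4)] I show ?thesis by simp
    next
      case (2 q)
      from isomorphic_swap[OF 2(1) j 2(2) i 2(3,4)] I show ?thesis by (simp add: insert_commute)
    qed
  next
    case 3
    with j(2) i(2) show ?thesis
    proof (cases rule: exists_offset_one_even)
      case (1 q)
      from isomorphic_swap[OF 1(1) j 1(2) i 1(3,4)] I show ?thesis by (simp add: insert_commute)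
    next
      case (2 q)
      from isomorphic_swap[OF 2(1) i 2(2) j 2(3,4)] I show ?thesis by simp
    qed
  qed
qed

end

theorem proposition3p44:
  fixes m :: nat
  assumes "odd m" and "m \<ge> 3"
  shows "strongly_hypomorphic (E m) (S1 m) (S2 m)"
  unfolding strongly_hypomorphic_def S1_def S2_def F1_eq F2_eq
  \<comment> \<open>The index \<open>False\<close> is the odd parity of \<open>F1\<close>, and its
    negation is that of \<open>F2\<close>.\<close>
  using sperner_H_F_parity[OF assms] isomorphic_pair[OF assms, where e = False] by simp

end
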